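(* Let $p$ be a prime number, let $\lambda:\mathbb Z/p\curvearrowright\mathcal G$ be an action by automorphisms on an ample groupoid $\mathcal G$ whose unit space is a Cantor set, free on $\mathcal G^{(0)}$, and put $\mathcal H:=\mathcal G\rtimes_\lambda\mathbb Z/p$. Assume that $\mathcal G$ and $\mathcal H$ are effective, minimal, and each either almost finite or purely infinite. Then \[\mathsf F(\mathcal G)\rtimes_\lambda\mathbb Z/p=\mathrm N(\mathsf F(\mathcal H),\mathsf F(\mathcal G))=\mathrm N(\mathsf F(\mathcal H),\mathsf D(\mathcal G)).\] This group is also the stabilizer in $\mathsf F(\mathcal H)$ of the partition of $\mathcal G^{(0)}$ into $\mathcal G$-orbits, that is, the group of all $\alpha\in\mathsf F(\mathcal H)$ mapping each $\mathcal G$-orbit onto a $\mathcal G$-orbit.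
   Context: Groupoids. An étale groupoid is a second countable locally compact Hausdorff topological groupoid whose range map is a local homeomorphism; $\mathcal G^{(0)}$ is the unit space, $s(g)=g^{-1}g$, $r(g)=gg^{-1}$. It is ample if $\mathcal G^{(0)}$ is totally disconnected. A bisection is a subset on which $r$ and $s$ are injective. The $\mathcal G$-orbit of $x\in\mathcal G^{(0)}$ is $r(s^{-1}(x))$; $\mathcal G$ is minimal if every orbit is dense in $\mathcal G^{(0)}$; effective if the interior of $\{g\mid r(g)=s(g)\}$ is $\mathcal G^{(0)}$; principal if $\{g\mid r(g)=s(g)\}=\mathcal G^{(0)}$. Full groups. For an effective ample groupoid with compact unit space, a full bisection is a compact open bisection $U$ with $r(U)=s(U)=\mathcal G^{(0)}$; $\theta_U:=r\circ(s|_U)^{-1}\in\mathrm{Homeo}(\mathcal G^{(0)})$. $\mathsf F(\mathcal G)$ is the group of all such $\theta_U$, $\mathsf D(\mathcal G)$ its commutator subgroup. $\mathrm N(\Gamma,S)=\{\alpha\in\Gamma\mid\alpha S\alpha^{-1}=S\}$. Almost finite / purely infinite. An elementary subgroupoid is a compact open principal subgroupoid $\mathcal K\subset\mathcal G$ with $\mathcal K^{(0)}=\mathcal G^{(0)}$; $\mathcal Kx=\{g\in\mathcal K\mid s(g)=x\}$. $\mathcal G$ is almost finite if for every compact $C\subset\mathcal G$ and $\varepsilon>0$ there is an elementary subgroupoid $\mathcal K$ with $\#(C\mathcal Kx\setminus\mathcal Kx)/\#(\mathcal Kx)<\varepsilon$ for all $x\in\mathcal G^{(0)}$. It is purely infinite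 if for every clopen $A\subset\mathcal G^{(0)}$ there are compact open bisections $U,V$ with $s(U)=s(V)=A$, $r(U)\cap r(V)=\emptyset$, $r(U)\cup r(V)\subset A$. Semidirect product. $\mathcal G\rtimes_\lambda\mathbb Z/p$ is $\mathcal G\times\mathbb Z/p$ with the product topology, unit space identified with $\mathcal G^{(0)}$, $r(g,a)=r(g)$, $s(g,a)=\lambda_a^{-1}(s(g))$, $(g,a)(h,b)=(g\lambda_a(h),a+b)$. $\mathcal G$ is identified with $\mathcal G\times\{0\}\subset\mathcal H$, so $\mathsf F(\mathcal G)\subset\mathsf F(\mathcal H)$. The restriction of $\lambda_a$ to $\mathcal G^{(0)}$ is an element of $\mathsf F(\mathcal H)$, again written $\lambda_a$, and $\mathsf F(\mathcal G)\rtimes_\lambda\mathbb Z/p$ denotes the subgroup of $\mathsf F(\mathcal H)$ generated by $\mathsf F(\mathcal G)$ and $\{\lambda_a\mid a\in\mathbb Z/p\}$ (an internal semidirect product). *)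

theory Defs
  imports "HOL-Analysis.Analysis" "HOL-Computational_Algebra.Primes" "HOL-Algebra.Elementary_Groups" "HOL-Algebra.Group_Action" "HOL-Algebra.Generated_Groups"
begin

section \<open>Topological groupoids\<close>

record 'a groupoid =
  gtop :: "'a topology"
  gmul :: "'a \<Rightarrow> 'a \<Rightarrow> 'a"
  ginv :: "'a \<Rightarrow> 'a"

text \<open>The arrows are the points of the topology.  The product \<open>gmul G g h\<close> is meaningful
  only for arrows with \<open>gsrc G g = grng G h\<close>, and units are themselves arrows.\<close>

definition arrows :: "'a groupoid \<Rightarrow> 'a set" where
  "arrows G = topspace (gtop G)"

definition gsrc :: "'a groupoid \<Rightarrow> 'a \<Rightarrow> 'a" where
  "gsrc G g = gmul G (ginv G g) g"

definition grng :: "'a groupoid \<Rightarrow> 'a \<Rightarrow> 'a" where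
  "grng G g = gmul G g (ginv G g)"

definition units :: "'a groupoid \<Rightarrow> 'a set" where
  "units G = grng G ` arrows G"

definition unit_space :: "'a groupoid \<Rightarrow> 'a topology" where
  "unit_space G = subtopology (gtop G) (units G)"

definition composable :: "'a groupoid \<Rightarrow> ('a \<times> 'a) set" where
  "composable G = {(g, h). g \<in> arrows G \<and> h \<in> arrows G \<and> gsrc G g = grng G h}"

locale groupoid =
  fixes G :: "'a groupoid"
  assumes inv_closed: "g \<in> arrows G \<Longrightarrow> ginv G g \<in> arrows G"
    and inv_inv: "g \<in> arrows G \<Longrightarrow> ginv G (ginv G g) = g"
    and mul_closed: "(g, h) \<in> composable G \<Longrightarrow> gmul G g h \<in> arrows G"
    and rng_mul: "(g, h) \<in> composable G \<Longrightarrow> grng G (gmul G g h) = grng G g"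
    and src_mul: "(g, h) \<in> composable G \<Longrightarrow> gsrc G (gmul G g h) = gsrc G h"
    and mul_assoc: "(g, h) \<in> composable G \<Longrightarrow> (h, k) \<in> composable G \<Longrightarrow>
          gmul G (gmul G g h) k = gmul G g (gmul G h k)"
    and inv_mul_cancel: "(g, h) \<in> composable G \<Longrightarrow> gmul G (ginv G g) (gmul G g h) = h"
    and mul_inv_cancel: "(g, h) \<in> composable G \<Longrightarrow> gmul G (gmul G g h) (ginv G h) = g"

locale topological_groupoid = groupoid +
  assumes continuous_mul:
      "continuous_map (subtopology (prod_topology (gtop G) (gtop G)) (composable G)) (gtop G)
         (\<lambda>(g, h). gmul G g h)"
    and continuous_inv: "continuous_map (gtop G) (gtop G) (ginv G)"

definition local_homeomorphism :: "'a topology \<Rightarrow> 'b topology \<Rightarrow> ('a \<Rightarrow> 'b) \<Rightarrow> bool" where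
  "local_homeomorphism X Y f \<longleftrightarrow>
     f ` topspace X \<subseteq> topspace Y \<and>
     (\<forall>x\<in>topspace X. \<exists>U. openin X U \<and> x \<in> U \<and> openin Y (f ` U) \<and>
        homeomorphic_map (subtopology X U) (subtopology Y (f ` U)) f)"

locale etale_groupoid = topological_groupoid +
  assumes second_countable: "second_countable (gtop G)"
    and locally_compact: "locally_compact_space (gtop G)"
    and Hausdorff: "Hausdorff_space (gtop G)"
    and local_homeo_rng: "local_homeomorphism (gtop G) (unit_space G) (grng G)"

definition totally_disconnected :: "'a topology \<Rightarrow> bool" where
  "totally_disconnected X \<longleftrightarrow> (\<forall>x\<in>topspace X. connected_component_of_set X x = {x})"

locale ample_groupoid = etale_groupoid +
  assumes totally_disconnected_units: "totally_disconnected (unit_space G)"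

definition cantor_set_space :: "'a topology \<Rightarrow> bool" where
  "cantor_set_space X \<longleftrightarrow>
     X homeomorphic_space product_topology (\<lambda>_::nat. discrete_topology (UNIV :: bool set)) UNIV"

definition gorbit :: "'a groupoid \<Rightarrow> 'a \<Rightarrow> 'a set" where
  "gorbit G x = grng G ` {g \<in> arrows G. gsrc G g = x}"

definition isotropy :: "'a groupoid \<Rightarrow> 'a set" where
  "isotropy G = {g \<in> arrows G. grng G g = gsrc G g}"

definition minimal :: "'a groupoid \<Rightarrow> bool" where
  "minimal G \<longleftrightarrow> (\<forall>x\<in>units G. unit_space G closure_of gorbit G x = units G)"

definition effective :: "'a groupoid \<Rightarrow> bool" where
  "effective G \<longleftrightarrow> gtop G interior_of isotropy G = units G"

definition principal :: "'a groupoid \<Rightarrow> bool" where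
  "principal G \<longleftrightarrow> isotropy G = units G"


section \<open>Full groups\<close>

definition bisection :: "'a groupoid \<Rightarrow> 'a set \<Rightarrow> bool" where
  "bisection G U \<longleftrightarrow> U \<subseteq> arrows G \<and> inj_on (grng G) U \<and> inj_on (gsrc G) U"

definition compact_open_bisection :: "'a groupoid \<Rightarrow> 'a set \<Rightarrow> bool" where
  "compact_open_bisection G U \<longleftrightarrow> compactin (gtop G) U \<and> openin (gtop G) U \<and> bisection G U"

definition full_bisection :: "'a groupoid \<Rightarrow> 'a set \<Rightarrow> bool" where
  "full_bisection G U \<longleftrightarrow>
     compact_open_bisection G U \<and> grng G ` U = units G \<and> gsrc G ` U = units G"

text \<open>Homeomorphisms of the unit space are represented as extensional functions, so that
  groups of them are subgroups of \<^const>\<open>BijGroup\<close>.\<close>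

definition bisection_homeo :: "'a groupoid \<Rightarrow> 'a set \<Rightarrow> 'a \<Rightarrow> 'a" where
  "bisection_homeo G U = (\<lambda>x\<in>units G. grng G (inv_into U (gsrc G) x))"

definition full_group :: "'a groupoid \<Rightarrow> ('a \<Rightarrow> 'a) set" where
  "full_group G = {bisection_homeo G U | U. full_bisection G U}"

definition full_group_derived :: "'a groupoid \<Rightarrow> ('a \<Rightarrow> 'a) set" where
  "full_group_derived G = derived (BijGroup (units G)) (full_group G)"

definition conj_stabilizer :: "('g, 'm) monoid_scheme \<Rightarrow> 'g set \<Rightarrow> 'g set \<Rightarrow> 'g set" where
  "conj_stabilizer B \<Gamma> S = {\<alpha>\<in>\<Gamma>. (\<lambda>\<sigma>. \<alpha> \<otimes>\<^bsub>B\<^esub> \<sigma> \<otimes>\<^bsub>B\<^esub> inv\<^bsub>B\<^esub> \<alpha>) ` S = S}"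


section \<open>Almost finite and purely infinite groupoids\<close>

definition subgroupoid :: "'a groupoid \<Rightarrow> 'a set \<Rightarrow> bool" where
  "subgroupoid G K \<longleftrightarrow>
     K \<subseteq> arrows G \<and> (\<forall>g\<in>K. ginv G g \<in> K) \<and>
     (\<forall>g\<in>K. \<forall>h\<in>K. gsrc G g = grng G h \<longrightarrow> gmul G g h \<in> K)"

definition restrict_groupoid :: "'a groupoid \<Rightarrow> 'a set \<Rightarrow> 'a groupoid" where
  "restrict_groupoid G K = G\<lparr>gtop := subtopology (gtop G) K\<rparr>"

definition elementary_subgroupoid :: "'a groupoid \<Rightarrow> 'a set \<Rightarrow> bool" where
  "elementary_subgroupoid G K \<longleftrightarrow>
     subgroupoid G K \<and> compactin (gtop G) K \<and> openin (gtop G) K \<and>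
     principal (restrict_groupoid G K) \<and> units (restrict_groupoid G K) = units G"

definition source_fibre :: "'a groupoid \<Rightarrow> 'a set \<Rightarrow> 'a \<Rightarrow> 'a set" where
  "source_fibre G K x = {g\<in>K. gsrc G g = x}"

definition set_mul :: "'a groupoid \<Rightarrow> 'a set \<Rightarrow> 'a set \<Rightarrow> 'a set" where
  "set_mul G C D = {gmul G c d | c d. c \<in> C \<and> d \<in> D \<and> gsrc G c = grng G d}"

text \<open>In an etale groupoid the source fibres of a compact set are finite, so both
  cardinalities below are genuine, and \<open>source_fibre G K x\<close> contains \<open>x\<close>.\<close>

definition almost_finite :: "'a groupoid \<Rightarrow> bool" where
  "almost_finite G \<longleftrightarrow>
     (\<forall>C. compactin (gtop G) C \<longrightarrow> (\<forall>\<epsilon>::real. \<epsilon> > 0 \<longrightarrow>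
       (\<exists>K. elementary_subgroupoid G K \<and>
          (\<forall>x\<in>units G.
             real (card (set_mul G C (source_fibre G K x) - source_fibre G K x))
               / real (card (source_fibre G K x)) < \<epsilon>))))"

definition purely_infinite :: "'a groupoid \<Rightarrow> bool" where
  "purely_infinite G \<longleftrightarrow>
     (\<forall>A. openin (unit_space G) A \<and> closedin (unit_space G) A \<longrightarrow>
       (\<exists>U V. compact_open_bisection G U \<and> compact_open_bisection G V \<and>
          gsrc G ` U = A \<and> gsrc G ` V = A \<and>
          grng G ` U \<inter> grng G ` V = {} \<and> grng G ` U \<union> grng G ` V \<subseteq> A))"


section \<open>Actions of cyclic groups and semidirect products\<close>

definition groupoid_automorphism :: "'a groupoid \<Rightarrow> ('a \<Rightarrow> 'a) \<Rightarrow> bool" where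
  "groupoid_automorphism G \<phi> \<longleftrightarrow>
     homeomorphic_map (gtop G) (gtop G) \<phi> \<and>
     (\<forall>(g, h)\<in>composable G.
        (\<phi> g, \<phi> h) \<in> composable G \<and> \<phi> (gmul G g h) = gmul G (\<phi> g) (\<phi> h))"

definition cyclic_action :: "nat \<Rightarrow> 'a groupoid \<Rightarrow> (int \<Rightarrow> 'a \<Rightarrow> 'a) \<Rightarrow> bool" where
  "cyclic_action p G lam \<longleftrightarrow>
     group_action (integer_mod_group p) (arrows G) lam \<and>
     (\<forall>a\<in>carrier (integer_mod_group p). groupoid_automorphism G (lam a))"

definition free_on_units :: "nat \<Rightarrow> 'a groupoid \<Rightarrow> (int \<Rightarrow> 'a \<Rightarrow> 'a) \<Rightarrow> bool" where
  "free_on_units p G lam \<longleftrightarrow>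
     (\<forall>a\<in>carrier (integer_mod_group p). \<forall>x\<in>units G. lam a x = x \<longrightarrow> a = \<one>\<^bsub>integer_mod_group p\<^esub>)"

definition semidirect :: "'a groupoid \<Rightarrow> nat \<Rightarrow> (int \<Rightarrow> 'a \<Rightarrow> 'a) \<Rightarrow> ('a \<times> int) groupoid" where
  "semidirect G p lam =
     (let Z = integer_mod_group p in
      \<lparr>gtop = prod_topology (gtop G) (discrete_topology (carrier Z)),
       gmul = (\<lambda>(g, a) (h, b). (gmul G g (lam a h), a \<otimes>\<^bsub>Z\<^esub> b)),
       ginv = (\<lambda>(g, a). (lam (inv\<^bsub>Z\<^esub> a) (ginv G g), inv\<^bsub>Z\<^esub> a))\<rparr>)"

text \<open>The unit space of the semidirect product consists of the pairs \<open>(x, 0)\<close> and is identified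
  with that of \<open>G\<close> via \<open>x \<mapsto> (x, 0)\<close>; the lemmas below confirm the usual range and source
  maps under this identification.\<close>

lemma lam_inverse:
  assumes "cyclic_action p G lam" "a \<in> carrier (integer_mod_group p)" "g \<in> arrows G"
  shows "lam a (lam (inv\<^bsub>integer_mod_group p\<^esub> a) g) = g"
proof -
  interpret group_action "integer_mod_group p" "arrows G" lam
    using assms(1) by (simp add: cyclic_action_def)
  interpret Z: group "integer_mod_group p" by simp
  have "lam a (lam (inv\<^bsub>integer_mod_group p\<^esub> a) g)
      = lam (a \<otimes>\<^bsub>integer_mod_group p\<^esub> inv\<^bsub>integer_mod_group p\<^esub> a) g"
    by (rule composition_rule[OF assms(3,2) Z.inv_closed[OF assms(2)], symmetric])
  also have "\<dots> = lam \<one>\<^bsub>integer_mod_group p\<^esub> g"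
    by (simp only: Z.r_inv[OF assms(2)])
  also have "\<dots> = g"
    using assms(3) by (simp only: id_eq_one[symmetric] restrict_apply')
  finally show ?thesis .
qed

lemma grng_semidirect:
  assumes "groupoid G" "cyclic_action p G lam" "a \<in> carrier (integer_mod_group p)" "g \<in> arrows G"
  shows "grng (semidirect G p lam) (g, a) = (grng G g, 0)"
proof -
  interpret groupoid G by fact
  interpret Z: group "integer_mod_group p" by simp
  show ?thesis
    using lam_inverse[OF assms(2,3) inv_closed[OF assms(4)]] Z.r_inv[OF assms(3)]
    by (simp add: grng_def semidirect_def Let_def del: inv_integer_mod_group)
qed

lemma gsrc_semidirect:
  assumes "groupoid G" "cyclic_action p G lam" "a \<in> carrier (integer_mod_group p)" "g \<in> arrows G"
  shows "gsrc (semidirect G p lam) (g, a) = (lam (inv\<^bsub>integer_mod_group p\<^esub> a) (gsrc G g), 0)"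
proof -
  interpret groupoid G by fact
  interpret Z: group "integer_mod_group p" by simp
  have "(ginv G g, g) \<in> composable G"
    using assms(4) inv_closed inv_inv by (simp add: composable_def gsrc_def grng_def)
  then have "lam (inv\<^bsub>integer_mod_group p\<^esub> a) (gmul G (ginv G g) g) =
      gmul G (lam (inv\<^bsub>integer_mod_group p\<^esub> a) (ginv G g)) (lam (inv\<^bsub>integer_mod_group p\<^esub> a) g)"
    using assms(2) Z.inv_closed[OF assms(3)]
    by (auto simp: cyclic_action_def groupoid_automorphism_def)
  then show ?thesis
    using Z.l_inv[OF assms(3)]
    by (simp add: gsrc_def semidirect_def Let_def del: inv_integer_mod_group)
qed

lemma units_semidirect:
  assumes "groupoid G" "cyclic_action p G lam"
  shows "units (semidirect G p lam) = units G \<times> {0}"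
proof -
  have arr: "arrows (semidirect G p lam) = arrows G \<times> carrier (integer_mod_group p)"
    by (simp add: arrows_def semidirect_def Let_def)
  have "0 \<in> carrier (integer_mod_group p)"
    by (simp add: carrier_integer_mod_group)
  then have "\<exists>a. a \<in> carrier (integer_mod_group p)"
    by blast
  moreover have "units (semidirect G p lam) =
      (\<lambda>(g, a). (grng G g, 0)) ` (arrows G \<times> carrier (integer_mod_group p))"
    unfolding units_def arr by (rule image_cong) (auto simp: grng_semidirect[OF assms])
  ultimately show ?thesis
    by (auto simp: units_def)
qed

text \<open>The full group of the semidirect product, acting on the unit space of \<open>G\<close> through
  this identification.\<close>

definition full_group_semidirect ::
    "'a groupoid \<Rightarrow> nat \<Rightarrow> (int \<Rightarrow> 'a \<Rightarrow> 'a) \<Rightarrow> ('a \<Rightarrow> 'a) set" where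
  "full_group_semidirect G p lam =
     (\<lambda>\<theta>. \<lambda>x\<in>units G. fst (\<theta> (x, 0))) ` full_group (semidirect G p lam)"

definition full_group_extension ::
    "'a groupoid \<Rightarrow> nat \<Rightarrow> (int \<Rightarrow> 'a \<Rightarrow> 'a) \<Rightarrow> ('a \<Rightarrow> 'a) set" where
  "full_group_extension G p lam =
     generate (BijGroup (units G))
       (full_group G \<union> {restrict (lam a) (units G) | a. a \<in> carrier (integer_mod_group p)})"

definition orbit_partition_stabilizer :: "'a groupoid \<Rightarrow> ('a \<Rightarrow> 'a) set \<Rightarrow> ('a \<Rightarrow> 'a) set" where
  "orbit_partition_stabilizer G \<Gamma> =
     {\<alpha>\<in>\<Gamma>. \<forall>x\<in>units G. \<exists>y\<in>units G. \<alpha> ` gorbit G x = gorbit G y}"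

end

theory Submission
  imports Defs
begin

text \<open>An element of the full group of \<open>G \<rtimes> \<int>/p\<close> is a homeomorphism \<open>\<alpha>\<close> together with a continuous
  label \<open>c\<close> with values in \<open>\<int>/p\<close> such that \<open>\<alpha> x\<close> lies in the \<open>G\<close>-orbit of \<open>\<lambda>\<^bsub>c x\<^esub> x\<close>; the constant
  labels give exactly the extension, which therefore normalizes \<open>F(G)\<close> and hence \<open>D(G)\<close>.  The orbits of
  \<open>D(G)\<close> are those of \<open>G\<close>, so its normalizer preserves the partition into \<open>G\<close>-orbits.  If, finally, \<open>\<alpha>\<close>
  preserves this partition, effectiveness of the semidirect product and Baire's theorem supply a unit \<open>x\<close>
  such that no \<open>\<lambda>\<^sub>a x\<close> with \<open>a \<noteq> 0\<close> lies in the orbit of \<open>x\<close>; the label is constant on the orbit of \<open>x\<close>,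
  which is dense, so it is constant.\<close>

text \<open>The label comes from the source formula of the semidirect product: an arrow
  \<open>(g, a)\<close> starting at \<open>x\<close> has \<open>gsrc G g = lam a x\<close>. Labels
  multiply by a cocycle rule, which is why constant labels cancel under conjugation. The obstacle is
  that the G-orbits do not determine the label at every unit: where \<open>lam d x\<close> lies in
  the G-orbit of \<open>x\<close> for some nontrivial \<open>d\<close>, two labels that differ by
  \<open>d\<close> lead from \<open>x\<close> into the same G-orbit. Effectiveness of the semidirect
  product does not exclude such units, being weaker than principality; it only makes them meagre. A
  single good unit is enough, because a continuous label with discrete values has closed level
  sets.\<close>

section \<open>Topology of the Cantor set\<close>

text \<open>A cylinder constraining finitely many coordinates is closed as well as open, because
  every subset of a discrete factor is closed; the homeomorphism carries this back to
  \<open>X\<close>.\<close>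

lemma zero_dimensional_cantor:
  assumes "cantor_set_space X" and "openin X W" and "x \<in> W"
  obtains A where "openin X A" "closedin X A" "x \<in> A" "A \<subseteq> W"
proof -
  let ?D = "discrete_topology (UNIV :: bool set)"
  let ?P = "product_topology (\<lambda>_::nat. ?D) UNIV"
  obtain f where f: "homeomorphic_map X ?P f"
    using assms(1) by (auto simp: cantor_set_space_def homeomorphic_space)
  have W: "W \<subseteq> topspace X" using assms(2) by (rule openin_subset)
  then have "openin ?P (f ` W)"
    using homeomorphic_map_openness[OF f] assms(2) by blast
  then obtain U where U: "finite {i. U i \<noteq> (UNIV :: bool set)}" "f x \<in> PiE UNIV U" "PiE UNIV U \<subseteq> f ` W"
    using assms(3) unfolding openin_product_topology_alt by fastforce
  have clop: "openin ?P (PiE UNIV U)" "closedin ?P (PiE UNIV U)"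
    using U(1) by (auto simp: closedin_product_topology intro!: product_topology_basis)
  define A where "A = {y \<in> topspace X. f y \<in> PiE UNIV U}"
  have "A \<subseteq> W"
  proof
    fix y assume y: "y \<in> A"
    then obtain w where "w \<in> W" "f y = f w" using U(3) by (auto simp: A_def)
    then show "y \<in> W"
      using y W homeomorphic_imp_injective_map[OF f] by (auto simp: A_def inj_on_def)
  qed
  moreover have "openin X A" "closedin X A"
    unfolding A_def using homeomorphic_imp_continuous_map[OF f] clop
    by (auto intro: openin_continuous_map_preimage closedin_continuous_map_preimage)
  moreover have "x \<in> A" using U(2) W assms(3) by (auto simp: A_def)
  ultimately show thesis using that by blast
qed

lemma infinite_cantor:
  assumes "cantor_set_space X"
  shows "infinite (topspace X)"
proof -
  obtain f where "homeomorphic_map X (product_topology (\<lambda>_::nat. discrete_topology (UNIV :: bool set)) UNIV) f"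
    using assms by (auto simp: cantor_set_space_def homeomorphic_space)
  then have "f ` topspace X = (UNIV :: (nat \<Rightarrow> bool) set)"
    by (auto dest: homeomorphic_imp_surjective_map)
  moreover have "infinite (UNIV :: (nat \<Rightarrow> bool) set)"
    by (simp add: finite_UNIV_fun)
  ultimately show ?thesis by (metis finite_imageI)
qed

lemma compact_cantor:
  assumes "cantor_set_space X"
  shows "compact_space X"
  using assms unfolding cantor_set_space_def
  by (simp add: homeomorphic_compact_space compact_space_product_topology compact_space_discrete_topology)

section \<open>Normalizers of subsets of a group\<close>

text \<open>The defining condition is an equality of sets, not an inclusion, so conjugating both
  sides by the inverse of \<open>a\<close> shows that inverses satisfy it too.\<close>

lemma (in group) conj_stabilizer_subgroup:
  assumes \<Gamma>: "subgroup \<Gamma> G" and S: "S \<subseteq> carrier G"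
  shows "subgroup (conj_stabilizer G \<Gamma> S) G"
proof (rule subgroupI)
  interpret \<Gamma>: subgroup \<Gamma> G by fact
  let ?c = "\<lambda>\<alpha> \<sigma>. \<alpha> \<otimes> \<sigma> \<otimes> inv \<alpha>"
  show "conj_stabilizer G \<Gamma> S \<subseteq> carrier G" by (auto simp: conj_stabilizer_def)
  have "?c \<one> ` S = S" using S by (auto simp: image_iff subset_iff)
  then show "conj_stabilizer G \<Gamma> S \<noteq> {}" by (auto simp: conj_stabilizer_def intro!: exI[of _ \<one>])
  show "inv a \<in> conj_stabilizer G \<Gamma> S" if "a \<in> conj_stabilizer G \<Gamma> S" for a
  proof -
    from that have a: "a \<in> \<Gamma>" "?c a ` S = S" by (auto simp: conj_stabilizer_def)
    have "?c (inv a) ` ?c a ` S = (\<lambda>x. x) ` S"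
      unfolding image_image using a S
      by (intro image_cong) (auto simp: m_assoc subset_iff, simp flip: m_assoc)
    then show ?thesis using a by (simp add: conj_stabilizer_def)
  qed
  show "a \<otimes> b \<in> conj_stabilizer G \<Gamma> S"
    if "a \<in> conj_stabilizer G \<Gamma> S" "b \<in> conj_stabilizer G \<Gamma> S" for a b
  proof -
    from that have a: "a \<in> \<Gamma>" "?c a ` S = S" and b: "b \<in> \<Gamma>" "?c b ` S = S"
      by (auto simp: conj_stabilizer_def)
    have "?c (a \<otimes> b) ` S = ?c a ` ?c b ` S"
      unfolding image_image using a b S
      by (intro image_cong) (auto simp: m_assoc subset_iff inv_mult_group)
    then show ?thesis using a b by (simp add: conj_stabilizer_def)
  qed
qed

text \<open>Conjugation by \<open>a\<close> gives one inclusion; conjugation by its inverse supplies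
  the preimages for the other.\<close>

lemma (in group) mem_conj_stabilizerI:
  assumes "a \<in> \<Gamma>" "a \<in> carrier G" "S \<subseteq> carrier G"
    and "\<And>\<sigma>. \<sigma> \<in> S \<Longrightarrow> a \<otimes> \<sigma> \<otimes> inv a \<in> S"
    and "\<And>\<sigma>. \<sigma> \<in> S \<Longrightarrow> inv a \<otimes> \<sigma> \<otimes> a \<in> S"
  shows "a \<in> conj_stabilizer G \<Gamma> S"
proof -
  have "\<sigma> \<in> (\<lambda>\<sigma>. a \<otimes> \<sigma> \<otimes> inv a) ` S" if \<sigma>: "\<sigma> \<in> S" for \<sigma>
  proof
    have "\<sigma> \<in> carrier G" using \<sigma> assms(3) by blast
    then show "\<sigma> = a \<otimes> (inv a \<otimes> \<sigma> \<otimes> a) \<otimes> inv a"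
      using assms(2) by (simp add: m_assoc) (simp flip: m_assoc)
    show "inv a \<otimes> \<sigma> \<otimes> a \<in> S" using assms(5) \<sigma> by blast
  qed
  then show ?thesis using assms by (auto simp: conj_stabilizer_def)
qed

text \<open>Conjugation by \<open>a\<close> is a homomorphism, and a homomorphism maps the derived
  subgroup of \<open>S\<close> onto that of the image of \<open>S\<close>, which is \<open>S\<close>
  again.\<close>

lemma (in group) conj_stabilizer_derived:
  assumes "\<Gamma> \<subseteq> carrier G" "S \<subseteq> carrier G"
  shows "conj_stabilizer G \<Gamma> S \<subseteq> conj_stabilizer G \<Gamma> (derived G S)"
proof
  fix a assume "a \<in> conj_stabilizer G \<Gamma> S"
  then have a: "a \<in> \<Gamma>" "(\<lambda>\<sigma>. a \<otimes> \<sigma> \<otimes> inv a) ` S = S" "a \<in> carrier G"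
    using assms(1) by (auto simp: conj_stabilizer_def)
  interpret h: group_hom G G "\<lambda>\<sigma>. a \<otimes> \<sigma> \<otimes> inv a"
    using a(3) by unfold_locales (auto simp: hom_def m_assoc, simp flip: m_assoc)
  show "a \<in> conj_stabilizer G \<Gamma> (derived G S)"
    using h.derived_img[OF assms(2)] a by (simp add: conj_stabilizer_def)
qed

section \<open>Groupoid algebra: units, automorphisms, orbits\<close>

context groupoid
begin

lemma composable_iff: "(g, h) \<in> composable G \<longleftrightarrow> g \<in> arrows G \<and> h \<in> arrows G \<and> gsrc G g = grng G h"
  by (simp add: composable_def)

lemma rng_inv: "g \<in> arrows G \<Longrightarrow> grng G (ginv G g) = gsrc G g"
  by (simp add: grng_def gsrc_def inv_inv)

lemma src_inv: "g \<in> arrows G \<Longrightarrow> gsrc G (ginv G g) = grng G g"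
  by (simp add: grng_def gsrc_def inv_inv)

lemma rng_in_units: "g \<in> arrows G \<Longrightarrow> grng G g \<in> units G"
  by (simp add: units_def)

lemma src_in_units: "g \<in> arrows G \<Longrightarrow> gsrc G g \<in> units G"
  by (metis inv_closed rng_in_units rng_inv)

lemma unit_arrow_src_rng:
  assumes "u \<in> units G"
  shows "u \<in> arrows G" "gsrc G u = u" "grng G u = u"
proof -
  obtain g where g: "g \<in> arrows G" "u = gmul G g (ginv G g)"
    using assms by (auto simp: units_def grng_def)
  then have c: "(g, ginv G g) \<in> composable G"
    by (simp add: composable_iff inv_closed rng_inv)
  show "u \<in> arrows G" using mul_closed[OF c] g by simp
  show "gsrc G u = u" using src_mul[OF c] g by (simp add: src_inv grng_def)
  show "grng G u = u" using rng_mul[OF c] g by (simp add: grng_def)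
qed

lemma units_subset: "units G \<subseteq> arrows G"
  using unit_arrow_src_rng by blast

lemma topspace_unit_space: "topspace (unit_space G) = units G"
  using units_subset by (auto simp: unit_space_def arrows_def)

lemma mul_src:
  assumes "g \<in> arrows G"
  shows "gmul G g (gsrc G g) = g"
  using inv_mul_cancel[of "ginv G g" g] assms
  by (simp add: composable_iff inv_closed inv_inv src_inv flip: gsrc_def)

text \<open>An automorphism is only required to respect products, so preservation of units must be
  derived: \<open>\<phi> u\<close> is idempotent, and cancellation turns an idempotent arrow into
  its own source and range.\<close>

lemma automorphism_unit:
  assumes \<phi>: "groupoid_automorphism G \<phi>" and u: "u \<in> units G"
  shows "gsrc G (\<phi> u) = \<phi> u" "grng G (\<phi> u) = \<phi> u"
proof -
  have "(u, u) \<in> composable G" "gmul G u u = u"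
    using unit_arrow_src_rng[OF u] mul_src[of u] by (auto simp: composable_iff)
  then have c: "(\<phi> u, \<phi> u) \<in> composable G" "gmul G (\<phi> u) (\<phi> u) = \<phi> u"
    using \<phi> unfolding groupoid_automorphism_def by force+
  show "gsrc G (\<phi> u) = \<phi> u" using inv_mul_cancel[OF c(1)] c(2) by (simp add: gsrc_def)
  show "grng G (\<phi> u) = \<phi> u" using mul_inv_cancel[OF c(1)] c(2) by (simp add: grng_def)
qed

text \<open>The composable pairs of \<open>g\<close> with its source and of its range with
  \<open>g\<close> stay composable under \<open>\<phi>\<close>, and the image of a unit is its own
  source and range.\<close>

lemma automorphism_src_rng:
  assumes \<phi>: "groupoid_automorphism G \<phi>" and g: "g \<in> arrows G"
  shows "gsrc G (\<phi> g) = \<phi> (gsrc G g)" "grng G (\<phi> g) = \<phi> (grng G g)"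
proof -
  have "(g, gsrc G g) \<in> composable G" "(grng G g, g) \<in> composable G"
    using g by (auto simp: composable_iff src_in_units rng_in_units unit_arrow_src_rng)
  then have "(\<phi> g, \<phi> (gsrc G g)) \<in> composable G" "(\<phi> (grng G g), \<phi> g) \<in> composable G"
    using \<phi> unfolding groupoid_automorphism_def by fast+
  then show "gsrc G (\<phi> g) = \<phi> (gsrc G g)" "grng G (\<phi> g) = \<phi> (grng G g)"
    using automorphism_unit[OF \<phi>] g by (auto simp: composable_iff src_in_units rng_in_units)
qed

lemma gorbit_iff: "y \<in> gorbit G x \<longleftrightarrow> (\<exists>g\<in>arrows G. gsrc G g = x \<and> grng G g = y)"
  by (auto simp: gorbit_def)

lemma gorbit_refl: "x \<in> units G \<Longrightarrow> x \<in> gorbit G x"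
  unfolding gorbit_iff using unit_arrow_src_rng by blast

lemma gorbit_subset: "gorbit G x \<subseteq> units G"
  by (auto simp: gorbit_iff rng_in_units)

lemma gorbit_sym: "y \<in> gorbit G x \<Longrightarrow> x \<in> gorbit G y"
  unfolding gorbit_iff by (metis inv_closed rng_inv src_inv)

lemma gorbit_trans: "y \<in> gorbit G x \<Longrightarrow> z \<in> gorbit G y \<Longrightarrow> z \<in> gorbit G x"
  unfolding gorbit_iff by (metis composable_iff mul_closed rng_mul src_mul)

lemma gorbit_eq: "y \<in> gorbit G x \<Longrightarrow> gorbit G y = gorbit G x"
  using gorbit_sym gorbit_trans by blast

end

text \<open>Continuous sections of the source map compose and invert without choosing preimages in a
  bisection, which makes the group structure of the full group accessible.\<close>

definition source_section :: "'a groupoid \<Rightarrow> ('a \<Rightarrow> 'a) \<Rightarrow> ('a \<Rightarrow> 'a) \<Rightarrow> bool" where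
  "source_section G \<alpha> \<sigma> \<longleftrightarrow> continuous_map (unit_space G) (gtop G) \<sigma> \<and>
     (\<forall>x\<in>units G. gsrc G (\<sigma> x) = x \<and> grng G (\<sigma> x) = \<alpha> x)"

section \<open>Full bisections as images of continuous sections\<close>

lemma bisection_homeo_eq:
  assumes "full_bisection G U" "u \<in> U"
  shows "bisection_homeo G U (gsrc G u) = grng G u"
proof -
  have "inj_on (gsrc G) U" "gsrc G u \<in> units G"
    using assms by (auto simp: full_bisection_def compact_open_bisection_def bisection_def)
  then show ?thesis using assms(2) by (simp add: bisection_homeo_def)
qed

text \<open>On the compact set \<open>U\<close> the source is a continuous bijection onto a
  Hausdorff space, so its inverse is continuous. The hypotheses here and in the next two lemmas are
  bare topological facts that can be checked both for \<open>G\<close> and for the semidirect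
  product.\<close>

lemma full_bisection_section:
  assumes sub: "units G \<subseteq> arrows G"
    and haus: "Hausdorff_space (unit_space G)"
    and src: "continuous_map (gtop G) (unit_space G) (gsrc G)"
    and U: "full_bisection G U"
  shows "bisection_homeo G U \<in> Bij (units G)"
    and "source_section G (bisection_homeo G U) (inv_into U (gsrc G))"
proof -
  have top: "topspace (unit_space G) = units G"
    using sub by (auto simp: unit_space_def arrows_def)
  have U': "compactin (gtop G) U" "U \<subseteq> arrows G" "inj_on (grng G) U" "inj_on (gsrc G) U"
      "grng G ` U = units G" "gsrc G ` U = units G"
    using U by (auto simp: full_bisection_def compact_open_bisection_def bisection_def)
  have topU: "topspace (subtopology (gtop G) U) = U"
    using U'(2) by (auto simp: arrows_def)
  have \<sigma>: "bij_betw (inv_into U (gsrc G)) (units G) U"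
    using U'(4,6) by (metis bij_betw_imageI bij_betw_inv_into)
  have "bij_betw (grng G \<circ> inv_into U (gsrc G)) (units G) (units G)"
    using \<sigma> by (rule bij_betw_trans) (use U'(3,5) in \<open>simp add: bij_betw_def\<close>)
  then have "bij_betw (bisection_homeo G U) (units G) (units G)"
    by (rule bij_betw_cong[THEN iffD1, rotated]) (simp add: bisection_homeo_def)
  then show "bisection_homeo G U \<in> Bij (units G)"
    by (simp add: Bij_def bisection_homeo_def)
  have "homeomorphic_map (subtopology (gtop G) U) (unit_space G) (gsrc G)"
    using src U' top topU haus
    by (intro continuous_imp_homeomorphic_map continuous_map_from_subtopology compact_space_subtopology) simp_all
  then obtain h where h: "homeomorphic_maps (subtopology (gtop G) U) (unit_space G) (gsrc G) h"
    by (auto simp: homeomorphic_map_maps)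
  have h_eq: "h x = inv_into U (gsrc G) x" if "x \<in> units G" for x
    using h that U'(4) top topU unfolding homeomorphic_maps_def
    by (metis continuous_map_image_subset_topspace image_subset_iff inv_into_f_f)
  have "continuous_map (unit_space G) (gtop G) h"
    using h unfolding homeomorphic_maps_def by (blast intro: continuous_map_into_fulltopology)
  then have "continuous_map (unit_space G) (gtop G) (inv_into U (gsrc G))"
    by (rule continuous_map_eq) (simp add: h_eq top)
  moreover have "gsrc G (inv_into U (gsrc G) x) = x" if "x \<in> units G" for x
    using U'(6) that by (intro f_inv_into_f) simp
  ultimately show "source_section G (bisection_homeo G U) (inv_into U (gsrc G))"
    by (simp add: source_section_def bisection_homeo_def)
qed

text \<open>Compactness is inherited from the unit space; openness is the real point. If the source
  is injective on an open \<open>V\<close> containing \<open>\<sigma> x\<close>, then any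
  \<open>v\<close> in \<open>V\<close> for which \<open>\<sigma> (gsrc G v)\<close> also lies in
  \<open>V\<close> must equal it. By continuity of \<open>\<sigma>\<close> these \<open>v\<close>
  form an open neighbourhood of \<open>\<sigma> x\<close> inside the image.\<close>

lemma source_section_image_full_bisection:
  assumes sub: "units G \<subseteq> arrows G"
    and comp: "compact_space (unit_space G)"
    and src: "continuous_map (gtop G) (unit_space G) (gsrc G)"
    and inj: "\<And>g. g \<in> arrows G \<Longrightarrow> \<exists>V. openin (gtop G) V \<and> g \<in> V \<and> inj_on (gsrc G) V"
    and \<alpha>: "\<alpha> \<in> Bij (units G)" and \<sigma>: "source_section G \<alpha> \<sigma>"
  shows "full_bisection G (\<sigma> ` units G)" "bisection_homeo G (\<sigma> ` units G) = \<alpha>"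
proof -
  have top: "topspace (unit_space G) = units G"
    using sub by (auto simp: unit_space_def arrows_def)
  have cont: "continuous_map (unit_space G) (gtop G) \<sigma>"
    and s: "\<And>x. x \<in> units G \<Longrightarrow> gsrc G (\<sigma> x) = x" and r: "\<And>x. x \<in> units G \<Longrightarrow> grng G (\<sigma> x) = \<alpha> x"
    using \<sigma> by (auto simp: source_section_def)
  have arr: "\<sigma> ` units G \<subseteq> arrows G"
    using continuous_map_image_subset_topspace[OF cont] top by (simp add: arrows_def)
  have "compactin (gtop G) (\<sigma> ` units G)"
    using comp cont top by (metis compact_space_def image_compactin)
  moreover have "openin (gtop G) (\<sigma> ` units G)"
  proof (subst openin_subopen, intro ballI)
    fix g assume "g \<in> \<sigma> ` units G"
    then obtain x where x: "x \<in> units G" "g = \<sigma> x" by blast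
    then obtain V where V: "openin (gtop G) V" "\<sigma> x \<in> V" "inj_on (gsrc G) V"
      using inj arr by blast
    define W where "W = {y \<in> topspace (unit_space G). \<sigma> y \<in> V}"
    have W: "openin (unit_space G) W"
      unfolding W_def using cont V(1) by (rule openin_continuous_map_preimage)
    let ?T = "{v \<in> V. gsrc G v \<in> W}"
    have "openin (gtop G) ?T"
      using src V(1) W by (rule openin_continuous_map_preimage_gen)
    moreover have "g \<in> ?T" using x V(2) s top by (simp add: W_def)
    moreover have "?T \<subseteq> \<sigma> ` units G"
    proof
      fix v assume v: "v \<in> ?T"
      then have "\<sigma> (gsrc G v) \<in> V" "gsrc G v \<in> units G" by (auto simp: W_def top)
      then have "v = \<sigma> (gsrc G v)" using V(3) v s by (auto simp: inj_on_def)
      then show "v \<in> \<sigma> ` units G" using \<open>gsrc G v \<in> units G\<close> by blast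
    qed
    ultimately show "\<exists>T. openin (gtop G) T \<and> g \<in> T \<and> T \<subseteq> \<sigma> ` units G" by blast
  qed
  moreover have "bisection G (\<sigma> ` units G)"
    using arr \<alpha> s r by (auto simp: bisection_def Bij_def bij_betw_def inj_on_def)
  moreover have "grng G ` \<sigma> ` units G = units G" "gsrc G ` \<sigma> ` units G = units G"
    using \<alpha> s r by (auto simp: Bij_def bij_betw_def image_image)
  ultimately show full: "full_bisection G (\<sigma> ` units G)"
    by (simp add: full_bisection_def compact_open_bisection_def)
  show "bisection_homeo G (\<sigma> ` units G) = \<alpha>"
  proof
    fix x
    show "bisection_homeo G (\<sigma> ` units G) x = \<alpha> x"
    proof (cases "x \<in> units G")
      case True
      then show ?thesis using bisection_homeo_eq[OF full, of "\<sigma> x"] s r by simp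
    next
      case False
      then show ?thesis
        using \<alpha> by (auto simp: bisection_homeo_def Bij_def extensional_def)
    qed
  qed
qed

lemma full_group_iff:
  assumes "units G \<subseteq> arrows G" and "compact_space (unit_space G)"
    and "Hausdorff_space (unit_space G)"
    and "continuous_map (gtop G) (unit_space G) (gsrc G)"
    and "\<And>g. g \<in> arrows G \<Longrightarrow> \<exists>V. openin (gtop G) V \<and> g \<in> V \<and> inj_on (gsrc G) V"
  shows "\<alpha> \<in> full_group G \<longleftrightarrow> \<alpha> \<in> Bij (units G) \<and> (\<exists>\<sigma>. source_section G \<alpha> \<sigma>)"
proof
  assume "\<alpha> \<in> full_group G"
  then show "\<alpha> \<in> Bij (units G) \<and> (\<exists>\<sigma>. source_section G \<alpha> \<sigma>)"
    using full_bisection_section[OF assms(1,3,4)] by (auto simp: full_group_def)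
next
  assume "\<alpha> \<in> Bij (units G) \<and> (\<exists>\<sigma>. source_section G \<alpha> \<sigma>)"
  then obtain \<sigma> where "\<alpha> \<in> Bij (units G)" "source_section G \<alpha> \<sigma>" by blast
  from source_section_image_full_bisection[OF assms(1,2,4,5) this]
  show "\<alpha> \<in> full_group G" by (auto simp: full_group_def)
qed

section \<open>Continuity, openness and local injectivity of range and source\<close>

context topological_groupoid
begin

lemma continuous_map_gmul:
  assumes "continuous_map T (gtop G) f" "continuous_map T (gtop G) g"
    and "\<And>x. x \<in> topspace T \<Longrightarrow> (f x, g x) \<in> composable G"
  shows "continuous_map T (gtop G) (\<lambda>x. gmul G (f x) (g x))"
proof -
  have "continuous_map T (subtopology (prod_topology (gtop G) (gtop G)) (composable G)) (\<lambda>x. (f x, g x))"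
    using assms by (auto simp: continuous_map_in_subtopology intro: continuous_map_pairedI)
  from continuous_map_compose[OF this continuous_mul] show ?thesis by (simp add: o_def)
qed

lemma continuous_map_ginv:
  "continuous_map T (gtop G) f \<Longrightarrow> continuous_map T (gtop G) (\<lambda>x. ginv G (f x))"
  using continuous_map_compose[OF _ continuous_inv, of T f] by (simp add: o_def)

lemma continuous_rng: "continuous_map (gtop G) (unit_space G) (grng G)"
proof -
  have "continuous_map (gtop G) (gtop G) (\<lambda>g. gmul G g (ginv G g))"
    by (intro continuous_map_gmul continuous_map_ginv continuous_map_id[unfolded id_def])
      (simp add: composable_iff inv_closed rng_inv flip: arrows_def)
  then show ?thesis
    unfolding unit_space_def
    by (auto simp: continuous_map_in_subtopology rng_in_units arrows_def[symmetric] simp flip: grng_def)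
qed

lemma continuous_src: "continuous_map (gtop G) (unit_space G) (gsrc G)"
proof (rule continuous_map_eq)
  show "continuous_map (gtop G) (unit_space G) (grng G \<circ> ginv G)"
    by (rule continuous_map_compose[OF continuous_inv continuous_rng])
qed (simp add: rng_inv flip: arrows_def)

lemma homeomorphic_map_ginv: "homeomorphic_map (gtop G) (gtop G) (ginv G)"
  unfolding homeomorphic_map_maps homeomorphic_maps_def
  using continuous_inv inv_inv by (auto simp: arrows_def)

end

context etale_groupoid
begin

lemma rng_locally_injective:
  assumes "g \<in> arrows G"
  obtains U where "openin (gtop G) U" "g \<in> U" "inj_on (grng G) U" "openin (unit_space G) (grng G ` U)"
    "homeomorphic_map (subtopology (gtop G) U) (subtopology (unit_space G) (grng G ` U)) (grng G)"
proof -
  obtain U where U: "openin (gtop G) U" "g \<in> U" "openin (unit_space G) (grng G ` U)"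
    "homeomorphic_map (subtopology (gtop G) U) (subtopology (unit_space G) (grng G ` U)) (grng G)"
    using local_homeo_rng assms by (auto simp: local_homeomorphism_def arrows_def)
  then have "inj_on (grng G) U"
    using homeomorphic_imp_injective_map[OF U(4)] openin_subset[OF U(1)] by (simp add: Int_absorb1)
  with U show thesis using that by blast
qed

text \<open>The etale axiom speaks of the range map; inversion exchanges range and source.\<close>

lemma src_locally_injective:
  assumes "g \<in> arrows G"
  shows "\<exists>V. openin (gtop G) V \<and> g \<in> V \<and> inj_on (gsrc G) V"
proof -
  obtain U where U: "openin (gtop G) U" "ginv G g \<in> U" "inj_on (grng G) U"
    using rng_locally_injective[OF inv_closed[OF assms]] by blast
  define V where "V = {h \<in> arrows G. ginv G h \<in> U}"
  have "openin (gtop G) V"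
    unfolding V_def arrows_def using continuous_inv U(1) by (rule openin_continuous_map_preimage)
  moreover have "inj_on (gsrc G) V"
  proof (rule inj_onI)
    fix h k assume hk: "h \<in> V" "k \<in> V" "gsrc G h = gsrc G k"
    then have "ginv G h = ginv G k"
      using U(3) by (auto simp: V_def rng_inv inj_on_def)
    then show "h = k" using hk by (metis (mono_tags, lifting) V_def inv_inv mem_Collect_eq)
  qed
  ultimately show ?thesis using U(2) assms by (auto simp: V_def)
qed

lemma open_rng:
  assumes W: "openin (gtop G) W"
  shows "openin (unit_space G) (grng G ` W)"
proof (subst openin_subopen, intro ballI)
  fix x assume "x \<in> grng G ` W"
  then obtain g where g: "g \<in> W" "x = grng G g" by blast
  then have "g \<in> arrows G" using openin_subset[OF W] by (auto simp: arrows_def)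
  then obtain U where U: "openin (gtop G) U" "g \<in> U" "openin (unit_space G) (grng G ` U)"
    "homeomorphic_map (subtopology (gtop G) U) (subtopology (unit_space G) (grng G ` U)) (grng G)"
    by (rule rng_locally_injective)
  have "openin (subtopology (gtop G) U) (W \<inter> U)"
    using W by (rule openin_subtopology_Int)
  then have "openin (subtopology (unit_space G) (grng G ` U)) (grng G ` (W \<inter> U))"
    using U(4) homeomorphic_map_openness_eq by blast
  then have "openin (unit_space G) (grng G ` (W \<inter> U))"
    using U(3) openin_trans_full by blast
  then show "\<exists>T. openin (unit_space G) T \<and> x \<in> T \<and> T \<subseteq> grng G ` W"
    using g U(2) by blast
qed

text \<open>Let the range be injective on a neighbourhood \<open>U\<close> of a unit. If
  \<open>g\<close> and its range both lie in \<open>U\<close>, they have the same range and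
  therefore coincide, so \<open>g\<close> is a unit.\<close>

lemma open_units: "openin (gtop G) (units G)"
proof (subst openin_subopen, intro ballI)
  fix u assume u: "u \<in> units G"
  then obtain U where U: "openin (gtop G) U" "u \<in> U" "inj_on (grng G) U"
    using rng_locally_injective unit_arrow_src_rng by metis
  let ?V = "{g \<in> U. grng G g \<in> U}"
  have "openin (gtop G) ?V"
    using U(1) continuous_map_into_fulltopology[OF continuous_rng[unfolded unit_space_def]]
    by (blast intro: openin_continuous_map_preimage_gen)
  moreover have "?V \<subseteq> units G"
  proof
    fix g assume g: "g \<in> ?V"
    then have a: "g \<in> arrows G" using openin_subset[OF U(1)] by (auto simp: arrows_def)
    then have "grng G (grng G g) = grng G g"
      using unit_arrow_src_rng rng_in_units by blast
    then have "grng G g = g" using U(3) g by (auto simp: inj_on_def)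
    then show "g \<in> units G" using rng_in_units[OF a] by simp
  qed
  ultimately show "\<exists>T. openin (gtop G) T \<and> u \<in> T \<and> T \<subseteq> units G"
    using u U(2) unit_arrow_src_rng[OF u] by force
qed

lemma Hausdorff_unit_space: "Hausdorff_space (unit_space G)"
  unfolding unit_space_def using Hausdorff by (rule Hausdorff_space_subtopology)

end

section \<open>Compact open bisections and swaps over a Cantor unit space\<close>

locale cantor_groupoid = ample_groupoid +
  assumes cantor: "cantor_set_space (unit_space G)"
begin

lemma compact_unit_space: "compact_space (unit_space G)"
  by (rule compact_cantor[OF cantor])

lemma full_group_iff_section: "\<alpha> \<in> full_group G \<longleftrightarrow> \<alpha> \<in> Bij (units G) \<and> (\<exists>\<sigma>. source_section G \<alpha> \<sigma>)"
  by (rule full_group_iff[OF units_subset compact_unit_space Hausdorff_unit_space continuous_src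
        src_locally_injective])

text \<open>A clopen set of units is compact, and the range, being a homeomorphism from
  \<open>U\<close> onto its image, carries this compactness back to the arrows of \<open>U\<close>
  above it. Zero-dimensionality makes the clopen set small enough to stay inside
  \<open>W\<close>.\<close>

lemma compact_open_bisection_base:
  assumes W: "openin (gtop G) W" and g: "g \<in> W"
  obtains V where "compact_open_bisection G V" "g \<in> V" "V \<subseteq> W"
proof -
  have ga: "g \<in> arrows G" using openin_subset[OF W] g by (auto simp: arrows_def)
  then obtain U where U: "openin (gtop G) U" "g \<in> U" "inj_on (grng G) U" "openin (unit_space G) (grng G ` U)"
    "homeomorphic_map (subtopology (gtop G) U) (subtopology (unit_space G) (grng G ` U)) (grng G)"
    by (rule rng_locally_injective)
  obtain U' where U': "openin (gtop G) U'" "g \<in> U'" "inj_on (gsrc G) U'"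
    using src_locally_injective[OF ga] by blast
  have "openin (unit_space G) (grng G ` (U \<inter> (U' \<inter> W)))"
    using U(1) U'(1) W by (intro open_rng openin_Int)
  then obtain A where A: "openin (unit_space G) A" "closedin (unit_space G) A" "grng G g \<in> A"
      "A \<subseteq> grng G ` (U \<inter> (U' \<inter> W))"
    using zero_dimensional_cantor[OF cantor, of "grng G ` (U \<inter> (U' \<inter> W))" "grng G g"] g U(2) U'(2) by blast
  define V where "V = {h \<in> U. grng G h \<in> A}"
  \<comment> \<open>\<open>V\<close> is cut out of all of \<open>U\<close>, where the range is known
    to be a homeomorphism; injectivity of the range on \<open>U\<close> then forces it into the
    smaller neighbourhood.\<close>
  have VU: "V \<subseteq> U \<inter> (U' \<inter> W)"
  proof
    fix h assume h: "h \<in> V"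
    then obtain k where "k \<in> U \<inter> (U' \<inter> W)" "grng G h = grng G k" using A(4) by (auto simp: V_def)
    then show "h \<in> U \<inter> (U' \<inter> W)" using h U(3) by (auto simp: V_def inj_on_def)
  qed
  have openV: "openin (gtop G) V"
    unfolding V_def by (rule openin_continuous_map_preimage_gen[OF continuous_rng U(1) A(1)])
  have "grng G ` V = A" using A(4) by (auto simp: V_def)
  moreover have "compactin (unit_space G) A"
    using compact_unit_space A(2) by (rule closedin_compact_space)
  ultimately have "compactin (subtopology (unit_space G) (grng G ` U)) (grng G ` V)"
    using A(4) by (auto simp: compactin_subtopology)
  then have "compactin (subtopology (gtop G) U) V"
    using homeomorphic_map_compactness[OF U(5), of V] VU openin_subset[OF openV] by auto
  then have "compactin (gtop G) V" by (simp add: compactin_subtopology)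
  moreover have "bisection G V"
    unfolding bisection_def using VU U(3) U'(3) openin_subset[OF openV]
    by (auto simp: arrows_def intro: inj_on_subset)
  ultimately have "compact_open_bisection G V"
    using openV by (simp add: compact_open_bisection_def)
  then show thesis using that VU g U(2) A(3) by (auto simp: V_def)
qed

text \<open>Take a small compact open bisection \<open>V\<close> around \<open>g\<close> with
  disjoint source and range sets, both missing \<open>z\<close>. The union of \<open>V\<close>, its
  inverse and the remaining units is a full bisection that exchanges the two sets and fixes
  everything else.\<close>

lemma full_group_swap:
  assumes g: "g \<in> arrows G" and neq: "gsrc G g \<noteq> grng G g"
    and z: "z \<in> units G" "z \<noteq> gsrc G g" "z \<noteq> grng G g"
  obtains t where "t \<in> full_group G" "t (gsrc G g) = grng G g" "t (grng G g) = gsrc G g" "t z = z"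
proof -
  let ?x = "gsrc G g" and ?y = "grng G g"
  have xy: "?x \<in> units G" "?y \<in> units G" using g by (auto simp: src_in_units rng_in_units)
  obtain P Q where PQ: "openin (unit_space G) P" "openin (unit_space G) Q" "?x \<in> P" "?y \<in> Q" "P \<inter> Q = {}"
    using Hausdorff_unit_space[unfolded Hausdorff_space_def, rule_format, of ?x ?y] neq xy
    unfolding topspace_unit_space disjnt_def by auto
  \<comment> \<open>Points are closed, so \<open>z\<close> can be removed from \<open>P\<close> and
    \<open>Q\<close> without losing openness; this is what later puts \<open>z\<close> among the
    fixed units \<open>R\<close>.\<close>
  have clz: "closedin (unit_space G) {z}"
    using Hausdorff_unit_space z(1) by (simp add: closedin_Hausdorff_sing_eq topspace_unit_space)
  define W where "W = {h \<in> {h \<in> arrows G. gsrc G h \<in> P - {z}}. grng G h \<in> Q - {z}}"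
  have "openin (gtop G) {h \<in> arrows G. gsrc G h \<in> P - {z}}"
    unfolding arrows_def using continuous_src openin_diff[OF PQ(1) clz] by (rule openin_continuous_map_preimage)
  then have "openin (gtop G) W"
    unfolding W_def by (rule openin_continuous_map_preimage_gen[OF continuous_rng _ openin_diff[OF PQ(2) clz]])
  moreover have "g \<in> W" using g PQ z by (auto simp: W_def)
  ultimately obtain V where V: "compact_open_bisection G V" "g \<in> V" "V \<subseteq> W"
    by (rule compact_open_bisection_base)
  have V': "compactin (gtop G) V" "openin (gtop G) V" "V \<subseteq> arrows G" "inj_on (grng G) V" "inj_on (gsrc G) V"
    using V(1) by (auto simp: compact_open_bisection_def bisection_def)
  let ?I = "ginv G ` V"
  have sI: "gsrc G ` ?I = grng G ` V" "grng G ` ?I = gsrc G ` V"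
    unfolding image_image using V'(3) by (auto simp: src_inv rng_inv intro!: image_cong)
  have I: "compactin (gtop G) ?I" "openin (gtop G) ?I" "?I \<subseteq> arrows G"
    "inj_on (grng G) ?I" "inj_on (gsrc G) ?I"
    using V' homeomorphic_map_openness[OF homeomorphic_map_ginv, of V] image_compactin[OF _ continuous_inv]
    by (auto simp: arrows_def[symmetric] inv_closed inj_on_def src_inv rng_inv subset_iff)
  define R where "R = units G - grng G ` V - gsrc G ` V"
  \<comment> \<open>Open because the range is an open map, applied to \<open>V\<close> and to its
    inverse; closed because they are compact in a Hausdorff space.\<close>
  have clop: "openin (unit_space G) (grng G ` V)" "closedin (unit_space G) (grng G ` V)"
    "openin (unit_space G) (gsrc G ` V)" "closedin (unit_space G) (gsrc G ` V)"
    using open_rng[OF V'(2)] open_rng[OF I(2)] sI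
      compactin_imp_closedin[OF Hausdorff_unit_space image_compactin[OF V'(1) continuous_rng]]
      compactin_imp_closedin[OF Hausdorff_unit_space image_compactin[OF V'(1) continuous_src]]
    by auto
  have units_clopen: "openin (unit_space G) (units G)" "closedin (unit_space G) (units G)"
    by (metis openin_topspace topspace_unit_space, metis closedin_topspace topspace_unit_space)
  have "closedin (unit_space G) R" "openin (unit_space G) R"
    unfolding R_def using clop units_clopen by (simp_all add: closedin_diff openin_diff)
  then have R: "compactin (gtop G) R" "openin (gtop G) R"
    using closedin_compact_space[OF compact_unit_space] openin_trans_full[OF _ open_units]
    by (auto simp: unit_space_def compactin_subtopology)
  have Rid: "gsrc G u = u" "grng G u = u" "u \<in> arrows G" if "u \<in> R" for u
    using that unit_arrow_src_rng by (auto simp: R_def)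
  have "gsrc G ` V \<subseteq> P" "grng G ` V \<subseteq> Q" using V(3) by (auto simp: W_def)
  then have disj: "gsrc G ` V \<inter> grng G ` V = {}" using PQ(5) by blast
  have sub: "gsrc G ` V \<subseteq> units G" "grng G ` V \<subseteq> units G"
    using V'(3) src_in_units rng_in_units by auto
  have Rim: "gsrc G ` R = R" "grng G ` R = R" using Rid by force+
  have RV: "R \<inter> grng G ` V = {}" "R \<inter> gsrc G ` V = {}" by (auto simp: R_def)
  have injR: "inj_on (grng G) R" "inj_on (gsrc G) R" using Rid by (auto simp: inj_on_def)
  define U where "U = V \<union> ?I \<union> R"
  have inj_Un: "inj_on f (S \<union> T)" if "inj_on f S" "inj_on f T" "f ` S \<inter> f ` T = {}" for f :: "'a \<Rightarrow> 'a" and S T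
    using that by (simp add: inj_on_Un) blast
  have inj: "inj_on (grng G) U" "inj_on (gsrc G) U"
    unfolding U_def by (intro inj_Un I V' injR; use disj RV sI Rim in \<open>simp add: image_Un; blast\<close>)+
  have "compactin (gtop G) U" "openin (gtop G) U"
    unfolding U_def using I V' R by (simp_all add: compactin_Un openin_Un)
  moreover have "U \<subseteq> arrows G"
    unfolding U_def using I(3) V'(3) Rid(3) by blast
  moreover have "grng G ` U = units G" "gsrc G ` U = units G"
    unfolding U_def image_Un sI Rim using sub by (auto simp only: R_def)
  ultimately have "full_bisection G U"
    using inj by (simp add: full_bisection_def compact_open_bisection_def bisection_def)
  moreover have "bisection_homeo G U ?x = ?y"
    using bisection_homeo_eq[OF \<open>full_bisection G U\<close>, of g] V(2) by (simp add: U_def)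
  moreover have "bisection_homeo G U ?y = ?x"
    using bisection_homeo_eq[OF \<open>full_bisection G U\<close>, of "ginv G g"] V(2) g by (simp add: U_def src_inv rng_inv)
  moreover have "z \<in> R" using V(3) z(1) by (auto simp: R_def W_def)
  then have "bisection_homeo G U z = z"
    using bisection_homeo_eq[OF \<open>full_bisection G U\<close>, of z] Rid[of z] by (simp add: U_def)
  ultimately show thesis using that by (auto simp: full_group_def)
qed

end

section \<open>Pointwise rules for the group of bijections\<close>

lemma BijGroup_mult_apply:
  "f \<in> Bij S \<Longrightarrow> g \<in> Bij S \<Longrightarrow> x \<in> S \<Longrightarrow> (f \<otimes>\<^bsub>BijGroup S\<^esub> g) x = f (g x)"
  by (simp add: BijGroup_def compose_def)

lemma carrier_BijGroup: "carrier (BijGroup S) = Bij S"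
  by (simp add: BijGroup_def)

lemma Bij_apply: "f \<in> Bij S \<Longrightarrow> x \<in> S \<Longrightarrow> f x \<in> S"
  by (blast dest: Bij_imp_funcset)

lemma inv_BijGroup_apply:
  assumes "f \<in> Bij S" "x \<in> S"
  shows "(inv\<^bsub>BijGroup S\<^esub> f) (f x) = x" "f ((inv\<^bsub>BijGroup S\<^esub> f) x) = x" "(inv\<^bsub>BijGroup S\<^esub> f) x \<in> S"
    "inv\<^bsub>BijGroup S\<^esub> f \<in> Bij S"
proof -
  have f: "inj_on f S" "f ` S = S" using assms(1) by (auto simp: Bij_def bij_betw_def)
  show "(inv\<^bsub>BijGroup S\<^esub> f) (f x) = x"
    using assms f by (simp add: inv_BijGroup Bij_apply)
  show "f ((inv\<^bsub>BijGroup S\<^esub> f) x) = x"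
    using assms f by (simp add: inv_BijGroup f_inv_into_f)
  show "(inv\<^bsub>BijGroup S\<^esub> f) x \<in> S"
    using assms by (simp add: inv_BijGroup Bij_inv_into_mem)
  show "inv\<^bsub>BijGroup S\<^esub> f \<in> Bij S"
    using assms by (simp add: inv_BijGroup restrict_inv_into_Bij)
qed

section \<open>The cyclic action and the calculus of labels\<close>

locale cantor_action = cantor_groupoid +
  fixes p :: nat and lam :: "int \<Rightarrow> 'a \<Rightarrow> 'a"
  assumes action: "cyclic_action p G lam"
begin

abbreviation Z :: "int monoid" where "Z \<equiv> integer_mod_group p"
abbreviation B :: "('a \<Rightarrow> 'a) monoid" where "B \<equiv> BijGroup (units G)"

sublocale Z: comm_group Z by simp

sublocale B: group B by (rule group_BijGroup)

sublocale lam: group_action Z "arrows G" lam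
  using action by (simp add: cyclic_action_def)

declare mult_integer_mod_group [simp del] inv_integer_mod_group [simp del] one_integer_mod_group [simp del]

lemma lam_automorphism: "a \<in> carrier Z \<Longrightarrow> groupoid_automorphism G (lam a)"
  using action by (simp add: cyclic_action_def)

lemma lam_arrow: "a \<in> carrier Z \<Longrightarrow> g \<in> arrows G \<Longrightarrow> lam a g \<in> arrows G"
  using lam.surj_prop by blast

lemma lam_src: "a \<in> carrier Z \<Longrightarrow> g \<in> arrows G \<Longrightarrow> gsrc G (lam a g) = lam a (gsrc G g)"
  by (rule automorphism_src_rng(1)[OF lam_automorphism])

lemma lam_rng: "a \<in> carrier Z \<Longrightarrow> g \<in> arrows G \<Longrightarrow> grng G (lam a g) = lam a (grng G g)"
  by (rule automorphism_src_rng(2)[OF lam_automorphism])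

lemma lam_unit: "a \<in> carrier Z \<Longrightarrow> x \<in> units G \<Longrightarrow> lam a x \<in> units G"
  by (metis lam_arrow lam_rng rng_in_units unit_arrow_src_rng(1,3))

lemma lam_one: "g \<in> arrows G \<Longrightarrow> lam \<one>\<^bsub>Z\<^esub> g = g"
  by (simp flip: lam.id_eq_one)

lemma lam_mult: "a \<in> carrier Z \<Longrightarrow> b \<in> carrier Z \<Longrightarrow> g \<in> arrows G \<Longrightarrow> lam (a \<otimes>\<^bsub>Z\<^esub> b) g = lam a (lam b g)"
  by (rule lam.composition_rule)

lemma lam_inv:
  assumes "a \<in> carrier Z" "g \<in> arrows G"
  shows "lam a (lam (inv\<^bsub>Z\<^esub> a) g) = g" "lam (inv\<^bsub>Z\<^esub> a) (lam a g) = g"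
  using assms lam_one by (simp_all flip: lam_mult)

lemma continuous_lam: "a \<in> carrier Z \<Longrightarrow> continuous_map (gtop G) (gtop G) (lam a)"
  using lam_automorphism by (auto simp: groupoid_automorphism_def dest: homeomorphic_imp_continuous_map)

text \<open>The label takes discrete values, so it is locally constant; on the open set where
  \<open>c\<close> equals \<open>a\<close> the map is \<open>lam a\<close> composed with
  \<open>f\<close>.\<close>

lemma continuous_map_lam:
  assumes f: "continuous_map T (gtop G) f" and c: "continuous_map T (discrete_topology (carrier Z)) c"
  shows "continuous_map T (gtop G) (\<lambda>x. lam (c x) (f x))"
  unfolding continuous_map_def
proof (intro conjI allI impI)
  have cZ: "c x \<in> carrier Z" if "x \<in> topspace T" for x
    using continuous_map_image_subset_topspace[OF c] that by auto
  have fa: "f x \<in> arrows G" if "x \<in> topspace T" for x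
    using continuous_map_image_subset_topspace[OF f] that by (auto simp: arrows_def)
  show "(\<lambda>x. lam (c x) (f x)) \<in> topspace T \<rightarrow> topspace (gtop G)"
    using cZ fa lam_arrow by (auto simp: arrows_def)
  fix U assume U: "openin (gtop G) U"
  have "openin T ({x \<in> topspace T. c x \<in> {a}} \<inter> {x \<in> topspace T. (lam a \<circ> f) x \<in> U})" if a: "a \<in> carrier Z" for a
    using a U by (intro openin_Int openin_continuous_map_preimage[OF c]
      openin_continuous_map_preimage[OF continuous_map_compose[OF f continuous_lam]]) auto
  then have "openin T (\<Union>a\<in>carrier Z. {x \<in> topspace T. c x \<in> {a}} \<inter> {x \<in> topspace T. (lam a \<circ> f) x \<in> U})"
    by blast
  also have "(\<Union>a\<in>carrier Z. {x \<in> topspace T. c x \<in> {a}} \<inter> {x \<in> topspace T. (lam a \<circ> f) x \<in> U})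
      = {x \<in> topspace T. lam (c x) (f x) \<in> U}"
    using cZ by auto
  finally show "openin T {x \<in> topspace T. lam (c x) (f x) \<in> U}" .
qed

text \<open>The pairs \<open>(\<sigma> x, c x)\<close> are the arrows of a full bisection of the semidirect product inducing \<open>\<alpha>\<close>.\<close>

definition labelled :: "('a \<Rightarrow> int) \<Rightarrow> ('a \<Rightarrow> 'a) \<Rightarrow> bool" where
  "labelled c \<alpha> \<longleftrightarrow> \<alpha> \<in> Bij (units G) \<and> continuous_map (unit_space G) (discrete_topology (carrier Z)) c \<and>
     (\<exists>\<sigma>. continuous_map (unit_space G) (gtop G) \<sigma> \<and>
        (\<forall>x\<in>units G. gsrc G (\<sigma> x) = lam (c x) x \<and> grng G (\<sigma> x) = \<alpha> x))"

lemma labelledE: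
  assumes "labelled c \<alpha>"
  obtains \<sigma> where "\<alpha> \<in> Bij (units G)" "continuous_map (unit_space G) (discrete_topology (carrier Z)) c"
    "continuous_map (unit_space G) (gtop G) \<sigma>"
    "\<And>x. x \<in> units G \<Longrightarrow> gsrc G (\<sigma> x) = lam (c x) x" "\<And>x. x \<in> units G \<Longrightarrow> grng G (\<sigma> x) = \<alpha> x"
    "\<And>x. x \<in> units G \<Longrightarrow> c x \<in> carrier Z" "\<And>x. x \<in> units G \<Longrightarrow> \<sigma> x \<in> arrows G"
proof -
  obtain \<sigma> where \<sigma>: "continuous_map (unit_space G) (gtop G) \<sigma>"
    "\<forall>x\<in>units G. gsrc G (\<sigma> x) = lam (c x) x \<and> grng G (\<sigma> x) = \<alpha> x"
    using assms unfolding labelled_def by blast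
  have c: "continuous_map (unit_space G) (discrete_topology (carrier Z)) c" "\<alpha> \<in> Bij (units G)"
    using assms by (simp_all add: labelled_def)
  show thesis
    using that[OF c(2,1) \<sigma>(1)] \<sigma>(2) continuous_map_image_subset_topspace[OF c(1)]
      continuous_map_image_subset_topspace[OF \<sigma>(1)]
    unfolding topspace_unit_space arrows_def topspace_discrete_topology by blast
qed

lemma labelled_cong:
  assumes "labelled c \<alpha>" "\<And>x. x \<in> units G \<Longrightarrow> c x = d x"
  shows "labelled d \<alpha>"
proof -
  have "continuous_map (unit_space G) (discrete_topology (carrier Z)) d"
    by (rule continuous_map_eq[of _ _ c]) (use assms in \<open>auto simp: labelled_def topspace_unit_space\<close>)
  then show ?thesis using assms by (simp add: labelled_def)
qed

lemma labelled_Bij: "labelled c \<alpha> \<Longrightarrow> \<alpha> \<in> Bij (units G)"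
  by (simp add: labelled_def)

lemma labelled_continuous:
  assumes "labelled c \<alpha>"
  shows "continuous_map (unit_space G) (unit_space G) \<alpha>"
proof -
  obtain \<sigma> where \<sigma>: "continuous_map (unit_space G) (gtop G) \<sigma>" "\<And>x. x \<in> units G \<Longrightarrow> grng G (\<sigma> x) = \<alpha> x"
    using assms by (rule labelledE) blast
  show ?thesis
    by (rule continuous_map_eq[OF continuous_map_compose[OF \<sigma>(1) continuous_rng]])
      (simp add: \<sigma>(2) topspace_unit_space)
qed

text \<open>A continuous bijection of a compact Hausdorff space is a homeomorphism; its topological
  inverse agrees on the units with the group inverse.\<close>

lemma labelled_continuous_inv:
  assumes "labelled c \<alpha>"
  shows "continuous_map (unit_space G) (unit_space G) (inv\<^bsub>B\<^esub> \<alpha>)"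
proof -
  have \<alpha>: "\<alpha> \<in> Bij (units G)" using assms by (rule labelled_Bij)
  then have "homeomorphic_map (unit_space G) (unit_space G) \<alpha>"
    using labelled_continuous[OF assms] compact_unit_space Hausdorff_unit_space
    by (intro continuous_imp_homeomorphic_map) (auto simp: topspace_unit_space Bij_def bij_betw_def)
  then obtain h where h: "homeomorphic_maps (unit_space G) (unit_space G) \<alpha> h"
    by (auto simp: homeomorphic_map_maps)
  have eq: "h x = (inv\<^bsub>B\<^esub> \<alpha>) x" if "x \<in> units G" for x
  proof -
    have "h (\<alpha> ((inv\<^bsub>B\<^esub> \<alpha>) x)) = (inv\<^bsub>B\<^esub> \<alpha>) x"
      using h inv_BijGroup_apply(3)[OF \<alpha> that] by (simp add: homeomorphic_maps_def topspace_unit_space)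
    then show ?thesis using inv_BijGroup_apply(2)[OF \<alpha> that] by simp
  qed
  have "continuous_map (unit_space G) (unit_space G) h"
    using h by (simp add: homeomorphic_maps_def)
  then show ?thesis
    by (rule continuous_map_eq) (simp add: eq topspace_unit_space)
qed

lemma continuous_label_mult:
  assumes "continuous_map T (discrete_topology (carrier Z)) c" "continuous_map T (discrete_topology (carrier Z)) d"
  shows "continuous_map T (discrete_topology (carrier Z)) (\<lambda>x. c x \<otimes>\<^bsub>Z\<^esub> d x)"
proof -
  have cd: "continuous_map T (discrete_topology (carrier Z \<times> carrier Z)) (\<lambda>x. (c x, d x))"
    unfolding prod_topology_discrete_topology using assms by (rule continuous_map_pairedI)
  have "continuous_map (discrete_topology (carrier Z \<times> carrier Z)) (discrete_topology (carrier Z))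
      (\<lambda>ab. fst ab \<otimes>\<^bsub>Z\<^esub> snd ab)"
    unfolding continuous_map_from_discrete_topology by (auto intro: Z.m_closed)
  from continuous_map_compose[OF cd this] show ?thesis by (simp add: o_def)
qed

text \<open>This is multiplication in the semidirect product: with \<open>a = c (\<beta> x)\<close>
  and \<open>b = d x\<close>, the product of \<open>(\<sigma> (\<beta> x), a)\<close> and
  \<open>(\<tau> x, b)\<close> has first coordinate
  \<open>gmul G (\<sigma> (\<beta> x)) (lam a (\<tau> x))\<close>, which is the section used
  below.\<close>

lemma labelled_mult:
  assumes \<alpha>: "labelled c \<alpha>" and \<beta>: "labelled d \<beta>"
  shows "labelled (\<lambda>x. c (\<beta> x) \<otimes>\<^bsub>Z\<^esub> d x) (\<alpha> \<otimes>\<^bsub>B\<^esub> \<beta>)"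
proof -
  obtain \<sigma> where s: "\<alpha> \<in> Bij (units G)" "continuous_map (unit_space G) (discrete_topology (carrier Z)) c"
    "continuous_map (unit_space G) (gtop G) \<sigma>"
    "\<And>x. x \<in> units G \<Longrightarrow> gsrc G (\<sigma> x) = lam (c x) x" "\<And>x. x \<in> units G \<Longrightarrow> grng G (\<sigma> x) = \<alpha> x"
    "\<And>x. x \<in> units G \<Longrightarrow> c x \<in> carrier Z" "\<And>x. x \<in> units G \<Longrightarrow> \<sigma> x \<in> arrows G"
    using \<alpha> by (rule labelledE) blast
  obtain \<tau> where t: "\<beta> \<in> Bij (units G)" "continuous_map (unit_space G) (discrete_topology (carrier Z)) d"
    "continuous_map (unit_space G) (gtop G) \<tau>"
    "\<And>x. x \<in> units G \<Longrightarrow> gsrc G (\<tau> x) = lam (d x) x" "\<And>x. x \<in> units G \<Longrightarrow> grng G (\<tau> x) = \<beta> x"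
    "\<And>x. x \<in> units G \<Longrightarrow> d x \<in> carrier Z" "\<And>x. x \<in> units G \<Longrightarrow> \<tau> x \<in> arrows G"
    using \<beta> by (rule labelledE) blast
  have \<beta>u: "\<beta> x \<in> units G" if "x \<in> units G" for x using t(1) that by (rule Bij_apply)
  have c\<beta>: "continuous_map (unit_space G) (discrete_topology (carrier Z)) (\<lambda>x. c (\<beta> x))"
    using continuous_map_compose[OF labelled_continuous[OF \<beta>] s(2)] by (simp add: o_def)
  have \<sigma>\<beta>: "continuous_map (unit_space G) (gtop G) (\<lambda>x. \<sigma> (\<beta> x))"
    using continuous_map_compose[OF labelled_continuous[OF \<beta>] s(3)] by (simp add: o_def)
  have comp: "(\<sigma> (\<beta> x), lam (c (\<beta> x)) (\<tau> x)) \<in> composable G" if "x \<in> units G" for x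
    using that \<beta>u s t by (simp add: composable_iff lam_arrow lam_rng)
  show ?thesis
    unfolding labelled_def
  proof (intro conjI exI ballI)
    show "\<alpha> \<otimes>\<^bsub>B\<^esub> \<beta> \<in> Bij (units G)"
      using B.m_closed s(1) t(1) by (simp add: carrier_BijGroup)
    show "continuous_map (unit_space G) (discrete_topology (carrier Z)) (\<lambda>x. c (\<beta> x) \<otimes>\<^bsub>Z\<^esub> d x)"
      using c\<beta> t(2) by (rule continuous_label_mult)
    show "continuous_map (unit_space G) (gtop G) (\<lambda>x. gmul G (\<sigma> (\<beta> x)) (lam (c (\<beta> x)) (\<tau> x)))"
      using comp by (intro continuous_map_gmul continuous_map_lam \<sigma>\<beta> c\<beta> t(3)) (simp add: topspace_unit_space)
    fix x assume x: "x \<in> units G"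
    then show "gsrc G (gmul G (\<sigma> (\<beta> x)) (lam (c (\<beta> x)) (\<tau> x))) = lam (c (\<beta> x) \<otimes>\<^bsub>Z\<^esub> d x) x"
      using src_mul[OF comp[OF x]] s t \<beta>u unit_arrow_src_rng(1)[OF x] by (simp add: lam_src lam_mult)
    show "grng G (gmul G (\<sigma> (\<beta> x)) (lam (c (\<beta> x)) (\<tau> x))) = (\<alpha> \<otimes>\<^bsub>B\<^esub> \<beta>) x"
      using rng_mul[OF comp[OF x]] s t \<beta>u x by (simp add: BijGroup_mult_apply)
  qed
qed

text \<open>The section and the label are the two coordinates of the inverse arrow in the semidirect
  product, taken at the preimage of \<open>x\<close> under \<open>\<alpha>\<close>.\<close>

lemma labelled_inv:
  assumes \<alpha>: "labelled c \<alpha>"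
  shows "labelled (\<lambda>x. inv\<^bsub>Z\<^esub> c ((inv\<^bsub>B\<^esub> \<alpha>) x)) (inv\<^bsub>B\<^esub> \<alpha>)"
proof -
  obtain \<sigma> where s: "\<alpha> \<in> Bij (units G)" "continuous_map (unit_space G) (discrete_topology (carrier Z)) c"
    "continuous_map (unit_space G) (gtop G) \<sigma>"
    "\<And>x. x \<in> units G \<Longrightarrow> gsrc G (\<sigma> x) = lam (c x) x" "\<And>x. x \<in> units G \<Longrightarrow> grng G (\<sigma> x) = \<alpha> x"
    "\<And>x. x \<in> units G \<Longrightarrow> c x \<in> carrier Z" "\<And>x. x \<in> units G \<Longrightarrow> \<sigma> x \<in> arrows G"
    using \<alpha> by (rule labelledE) blast
  let ?\<beta> = "inv\<^bsub>B\<^esub> \<alpha>"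
  have \<beta>u: "?\<beta> x \<in> units G" "\<alpha> (?\<beta> x) = x" if "x \<in> units G" for x
    using inv_BijGroup_apply[OF s(1) that] by auto
  have "continuous_map (discrete_topology (carrier Z)) (discrete_topology (carrier Z)) (\<lambda>a. inv\<^bsub>Z\<^esub> a)"
    by auto
  from continuous_map_compose[OF continuous_map_compose[OF labelled_continuous_inv[OF \<alpha>] s(2)] this]
  have c\<beta>: "continuous_map (unit_space G) (discrete_topology (carrier Z)) (\<lambda>x. inv\<^bsub>Z\<^esub> c (?\<beta> x))"
    by (simp add: o_def)
  have \<sigma>\<beta>: "continuous_map (unit_space G) (gtop G) (\<lambda>x. \<sigma> (?\<beta> x))"
    using continuous_map_compose[OF labelled_continuous_inv[OF \<alpha>] s(3)] by (simp add: o_def)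
  show ?thesis
    unfolding labelled_def
  proof (intro conjI exI ballI)
    show "?\<beta> \<in> Bij (units G)"
      using B.inv_closed s(1) by (simp add: carrier_BijGroup)
    show "continuous_map (unit_space G) (discrete_topology (carrier Z)) (\<lambda>x. inv\<^bsub>Z\<^esub> c (?\<beta> x))"
      by (rule c\<beta>)
    show "continuous_map (unit_space G) (gtop G) (\<lambda>x. lam (inv\<^bsub>Z\<^esub> c (?\<beta> x)) (ginv G (\<sigma> (?\<beta> x))))"
      by (intro continuous_map_lam continuous_map_ginv \<sigma>\<beta> c\<beta>)
    fix x assume x: "x \<in> units G"
    show "gsrc G (lam (inv\<^bsub>Z\<^esub> c (?\<beta> x)) (ginv G (\<sigma> (?\<beta> x)))) = lam (inv\<^bsub>Z\<^esub> c (?\<beta> x)) x"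
      using s \<beta>u x by (simp add: lam_src src_inv inv_closed)
    show "grng G (lam (inv\<^bsub>Z\<^esub> c (?\<beta> x)) (ginv G (\<sigma> (?\<beta> x)))) = ?\<beta> x"
      using s \<beta>u x unit_arrow_src_rng(1) by (simp add: lam_rng rng_inv inv_closed lam_inv)
  qed
qed

text \<open>The section is \<open>lam a\<close> itself: the unit \<open>lam a x\<close> is its own
  source and range, which are the values required on both sides.\<close>

lemma labelled_lam:
  assumes a: "a \<in> carrier Z"
  shows "labelled (\<lambda>_. a) (restrict (lam a) (units G))"
  unfolding labelled_def
proof (intro conjI exI ballI)
  have "bij_betw (lam a) (units G) (units G)"
    by (rule bij_betw_byWitness[where f' = "lam (inv\<^bsub>Z\<^esub> a)"])
      (use a in \<open>auto simp: lam_inv lam_unit unit_arrow_src_rng(1)\<close>)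
  then show "restrict (lam a) (units G) \<in> Bij (units G)"
    by (simp add: Bij_def)
  show "continuous_map (unit_space G) (gtop G) (lam a)"
    unfolding unit_space_def using continuous_lam[OF a] by (rule continuous_map_from_subtopology)
  show "gsrc G (lam a x) = lam a x" "grng G (lam a x) = restrict (lam a) (units G) x" if "x \<in> units G" for x
    using lam_unit[OF a that] that by (auto simp: unit_arrow_src_rng)
qed (use a in simp)

lemma labelled_one: "labelled (\<lambda>_. \<one>\<^bsub>Z\<^esub>) \<one>\<^bsub>B\<^esub>"
proof -
  have "restrict (lam \<one>\<^bsub>Z\<^esub>) (units G) = \<one>\<^bsub>B\<^esub>"
    by (rule ext) (simp add: BijGroup_def restrict_def lam_one unit_arrow_src_rng(1))
  then show ?thesis using labelled_lam[OF Z.one_closed] by simp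
qed

text \<open>The neutral element acts as the identity, so a section with trivial label is an ordinary
  source section of \<open>G\<close>. This is the inclusion of F(G) in F(H) given by
  \<open>G\<close> sitting in the semidirect product at label zero, and it makes the group laws of
  F(G) special cases of those for labels.\<close>

lemma full_group_iff_labelled: "\<alpha> \<in> full_group G \<longleftrightarrow> labelled (\<lambda>_. \<one>\<^bsub>Z\<^esub>) \<alpha>"
  unfolding full_group_iff_section labelled_def source_section_def
  by (simp add: lam_one unit_arrow_src_rng(1) cong: conj_cong)

lemma full_group_subset: "full_group G \<subseteq> carrier B"
  by (auto simp: full_group_iff_labelled carrier_BijGroup labelled_Bij)

lemma subgroup_full_group: "subgroup (full_group G) B"
proof (rule B.subgroupI)
  show "full_group G \<noteq> {}" using labelled_one full_group_iff_labelled by blast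
  show "inv\<^bsub>B\<^esub> \<alpha> \<in> full_group G" if "\<alpha> \<in> full_group G" for \<alpha>
    using labelled_inv[of "\<lambda>_. \<one>\<^bsub>Z\<^esub>" \<alpha>] that by (simp add: full_group_iff_labelled)
  show "\<alpha> \<otimes>\<^bsub>B\<^esub> \<beta> \<in> full_group G" if "\<alpha> \<in> full_group G" "\<beta> \<in> full_group G" for \<alpha> \<beta>
    using labelled_mult[of "\<lambda>_. \<one>\<^bsub>Z\<^esub>" \<alpha> "\<lambda>_. \<one>\<^bsub>Z\<^esub>" \<beta>] that by (simp add: full_group_iff_labelled)
qed (rule full_group_subset)

section \<open>The full group of the semidirect product in terms of labels\<close>

abbreviation H :: "('a \<times> int) groupoid" where "H \<equiv> semidirect G p lam"

lemma gtop_semidirect: "gtop H = prod_topology (gtop G) (discrete_topology (carrier Z))"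
  by (simp add: semidirect_def Let_def)

lemma arrows_semidirect: "arrows H = arrows G \<times> carrier Z"
  by (simp add: arrows_def gtop_semidirect)

lemma units_H: "units H = units G \<times> {\<one>\<^bsub>Z\<^esub>}"
  using units_semidirect[OF groupoid_axioms action] by (simp add: one_integer_mod_group)

lemma src_H: "a \<in> carrier Z \<Longrightarrow> g \<in> arrows G \<Longrightarrow> gsrc H (g, a) = (lam (inv\<^bsub>Z\<^esub> a) (gsrc G g), \<one>\<^bsub>Z\<^esub>)"
  using gsrc_semidirect[OF groupoid_axioms action] by (simp add: one_integer_mod_group)

lemma rng_H: "a \<in> carrier Z \<Longrightarrow> g \<in> arrows G \<Longrightarrow> grng H (g, a) = (grng G g, \<one>\<^bsub>Z\<^esub>)"
  using grng_semidirect[OF groupoid_axioms action] by (simp add: one_integer_mod_group)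

lemma units_H_subset: "units H \<subseteq> arrows H"
  using units_subset Z.one_closed by (auto simp: units_H arrows_semidirect)

lemma topspace_unit_space_H: "topspace (unit_space H) = units G \<times> {\<one>\<^bsub>Z\<^esub>}"
  using units_H_subset by (auto simp: unit_space_def units_H arrows_def)

lemma continuous_unit_embedding: "continuous_map (unit_space G) (unit_space H) (\<lambda>x. (x, \<one>\<^bsub>Z\<^esub>))"
proof -
  have "continuous_map (unit_space G) (gtop G) (\<lambda>x. x)"
    unfolding unit_space_def by (rule continuous_map_from_subtopology) (simp add: continuous_map_id[unfolded id_def])
  then have "continuous_map (unit_space G) (gtop H) (\<lambda>x. (x, \<one>\<^bsub>Z\<^esub>))"
    unfolding gtop_semidirect by (intro continuous_map_pairedI) simp_all
  then show ?thesis
    unfolding unit_space_def[of H] units_H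
    by (rule continuous_map_into_subtopology) (simp add: topspace_unit_space)
qed

lemma continuous_unit_projection: "continuous_map (unit_space H) (unit_space G) fst"
proof -
  have "continuous_map (unit_space H) (gtop G) fst"
    unfolding unit_space_def[of H] gtop_semidirect
    by (rule continuous_map_from_subtopology[OF continuous_map_fst])
  then show ?thesis
    unfolding unit_space_def[of G]
    by (rule continuous_map_into_subtopology) (auto simp: topspace_unit_space_H)
qed

lemma compact_unit_space_H: "compact_space (unit_space H)"
proof -
  have "compactin (unit_space H) ((\<lambda>x. (x, \<one>\<^bsub>Z\<^esub>)) ` units G)"
    using compact_unit_space topspace_unit_space
    by (intro image_compactin[OF _ continuous_unit_embedding]) (simp add: compact_space_def)
  moreover have "(\<lambda>x. (x, \<one>\<^bsub>Z\<^esub>)) ` units G = topspace (unit_space H)"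
    by (auto simp: topspace_unit_space_H)
  ultimately show ?thesis by (simp add: compact_space_def)
qed

lemma Hausdorff_unit_space_H: "Hausdorff_space (unit_space H)"
  unfolding unit_space_def gtop_semidirect
  using Hausdorff by (intro Hausdorff_space_subtopology) (simp add: Hausdorff_space_prod_topology)

lemma continuous_src_H: "continuous_map (gtop H) (unit_space H) (gsrc H)"
proof -
  have "continuous_map (gtop H) (gtop G) (gsrc G \<circ> fst)"
    unfolding gtop_semidirect
    using continuous_map_into_fulltopology[OF continuous_src[unfolded unit_space_def]]
    by (rule continuous_map_compose[OF continuous_map_fst])
  moreover have "continuous_map (gtop H) (discrete_topology (carrier Z)) (m_inv Z \<circ> snd)"
    unfolding gtop_semidirect
    by (rule continuous_map_compose[OF continuous_map_snd]) auto
  ultimately have "continuous_map (gtop H) (gtop G) (\<lambda>z. lam ((m_inv Z \<circ> snd) z) ((gsrc G \<circ> fst) z))"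
    by (rule continuous_map_lam)
  then have "continuous_map (gtop H) (gtop G) (\<lambda>z. lam (inv\<^bsub>Z\<^esub> snd z) (gsrc G (fst z)))"
    by (simp add: o_def)
  then have "continuous_map (gtop H) (unit_space G) (\<lambda>z. lam (inv\<^bsub>Z\<^esub> snd z) (gsrc G (fst z)))"
    unfolding unit_space_def[of G]
    by (rule continuous_map_into_subtopology)
      (auto simp: arrows_semidirect lam_unit src_in_units simp flip: arrows_def)
  from continuous_map_compose[OF this continuous_unit_embedding]
  show ?thesis
    by (rule continuous_map_eq) (auto simp: arrows_semidirect src_H simp flip: arrows_def)
qed

text \<open>On a slice with constant second coordinate \<open>a\<close>, which is open because
  labels are discrete, the source is the source of \<open>G\<close> followed by the injective action
  of the inverse of \<open>a\<close>.\<close>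

lemma src_locally_injective_H:
  assumes "z \<in> arrows H"
  shows "\<exists>V. openin (gtop H) V \<and> z \<in> V \<and> inj_on (gsrc H) V"
proof -
  obtain g a where z: "z = (g, a)" "g \<in> arrows G" "a \<in> carrier Z"
    using assms by (auto simp: arrows_semidirect)
  obtain V where V: "openin (gtop G) V" "g \<in> V" "inj_on (gsrc G) V"
    using src_locally_injective[OF z(2)] by blast
  have VG: "V \<subseteq> arrows G" using openin_subset[OF V(1)] by (simp add: arrows_def)
  have "openin (gtop H) (V \<times> {a})"
    unfolding gtop_semidirect openin_prod_Times_iff using V(1) z(3) by simp
  moreover have "inj_on (gsrc H) (V \<times> {a})"
  proof (rule inj_onI)
    fix z w assume "z \<in> V \<times> {a}" "w \<in> V \<times> {a}" and eq: "gsrc H z = gsrc H w"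
    then obtain h k where zw: "z = (h, a)" "w = (k, a)" and hk: "h \<in> V" "k \<in> V" by auto
    then have "h \<in> arrows G" "k \<in> arrows G" using VG by auto
    then have "lam (inv\<^bsub>Z\<^esub> a) (gsrc G h) = lam (inv\<^bsub>Z\<^esub> a) (gsrc G k)"
      using eq z(3) by (simp add: zw src_H)
    then have "gsrc G h = gsrc G k"
      using lam.inj_prop[of "inv\<^bsub>Z\<^esub> a"] z(3) \<open>h \<in> arrows G\<close> \<open>k \<in> arrows G\<close> units_subset src_in_units
      by (auto simp: inj_on_def subset_iff)
    then show "z = w" using V(3) hk by (auto simp: zw inj_on_def)
  qed
  ultimately show ?thesis using z V(2) by blast
qed

lemma full_group_H_iff: "\<theta> \<in> full_group H \<longleftrightarrow> \<theta> \<in> Bij (units H) \<and> (\<exists>\<tau>. source_section H \<theta> \<tau>)"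
  by (rule full_group_iff[OF units_H_subset compact_unit_space_H Hausdorff_unit_space_H
        continuous_src_H src_locally_injective_H])

text \<open>The two coordinates of a section for the semidirect product are the section and the
  label. The source formula gives \<open>x\<close> as the inverse of \<open>c x\<close> acting on
  the source of \<open>\<sigma> x\<close>; solving for that source yields
  \<open>lam (c x) x\<close>.\<close>

lemma full_group_H_imp_labelled:
  assumes "\<theta> \<in> full_group H"
  shows "\<exists>c. labelled c (\<lambda>x\<in>units G. fst (\<theta> (x, \<one>\<^bsub>Z\<^esub>)))"
proof -
  obtain \<tau> where \<theta>: "\<theta> \<in> Bij (units H)" and \<tau>: "continuous_map (unit_space H) (gtop H) \<tau>"
    "\<And>z. z \<in> units H \<Longrightarrow> gsrc H (\<tau> z) = z" "\<And>z. z \<in> units H \<Longrightarrow> grng H (\<tau> z) = \<theta> z"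
    using assms unfolding full_group_H_iff source_section_def by blast
  define \<sigma> where "\<sigma> = (\<lambda>x. fst (\<tau> (x, \<one>\<^bsub>Z\<^esub>)))"
  define c where "c = (\<lambda>x. snd (\<tau> (x, \<one>\<^bsub>Z\<^esub>)))"
  have \<tau>': "continuous_map (unit_space G) (prod_topology (gtop G) (discrete_topology (carrier Z))) (\<lambda>x. \<tau> (x, \<one>\<^bsub>Z\<^esub>))"
    using continuous_map_compose[OF continuous_unit_embedding \<tau>(1)] by (simp add: o_def gtop_semidirect)
  have cont: "continuous_map (unit_space G) (gtop G) \<sigma>"
      "continuous_map (unit_space G) (discrete_topology (carrier Z)) c"
    using continuous_map_compose[OF \<tau>' continuous_map_fst] continuous_map_compose[OF \<tau>' continuous_map_snd]
    by (simp_all add: \<sigma>_def c_def o_def)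
  have mem: "\<sigma> x \<in> arrows G" "c x \<in> carrier Z" if "x \<in> units G" for x
    using continuous_map_image_subset_topspace[OF cont(1)] continuous_map_image_subset_topspace[OF cont(2)] that
    by (auto simp: topspace_unit_space arrows_def)
  have src: "gsrc G (\<sigma> x) = lam (c x) x" if "x \<in> units G" for x
  proof -
    have "gsrc H (\<sigma> x, c x) = (x, \<one>\<^bsub>Z\<^esub>)"
      using \<tau>(2)[of "(x, \<one>\<^bsub>Z\<^esub>)"] that by (simp add: \<sigma>_def c_def units_H)
    then have "lam (inv\<^bsub>Z\<^esub> c x) (gsrc G (\<sigma> x)) = x" using mem[OF that] by (simp add: src_H)
    then show ?thesis
      using lam_inv(1)[of "c x" "gsrc G (\<sigma> x)"] mem[OF that] unit_arrow_src_rng(1) src_in_units by metis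
  qed
  have \<theta>_eq: "\<theta> (x, \<one>\<^bsub>Z\<^esub>) = (grng G (\<sigma> x), \<one>\<^bsub>Z\<^esub>)" if "x \<in> units G" for x
  proof -
    have "grng H (\<sigma> x, c x) = \<theta> (x, \<one>\<^bsub>Z\<^esub>)"
      using \<tau>(3)[of "(x, \<one>\<^bsub>Z\<^esub>)"] that by (simp add: \<sigma>_def c_def units_H)
    then show ?thesis using mem[OF that] by (simp add: rng_H)
  qed
  have bij: "bij_betw \<theta> (units G \<times> {\<one>\<^bsub>Z\<^esub>}) (units G \<times> {\<one>\<^bsub>Z\<^esub>})"
    using \<theta> by (simp add: Bij_def units_H)
  have pair: "bij_betw (\<lambda>x. (x, \<one>\<^bsub>Z\<^esub>)) (units G) (units G \<times> {\<one>\<^bsub>Z\<^esub>})"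
    "bij_betw fst (units G \<times> {\<one>\<^bsub>Z\<^esub>}) (units G)"
    by (auto simp: bij_betw_def inj_on_def)
  have "bij_betw (fst \<circ> (\<theta> \<circ> (\<lambda>x. (x, \<one>\<^bsub>Z\<^esub>)))) (units G) (units G)"
    by (rule bij_betw_trans[OF bij_betw_trans[OF pair(1) bij] pair(2)])
  then have "(\<lambda>x\<in>units G. fst (\<theta> (x, \<one>\<^bsub>Z\<^esub>))) \<in> Bij (units G)"
    by (simp add: Bij_def o_def)
  then have "labelled c (\<lambda>x\<in>units G. fst (\<theta> (x, \<one>\<^bsub>Z\<^esub>)))"
    unfolding labelled_def using cont src by (auto simp: \<theta>_eq)
  then show ?thesis by blast
qed

lemma labelled_imp_full_group_H:
  assumes "labelled c \<alpha>"
  shows "(\<lambda>z\<in>units H. (\<alpha> (fst z), \<one>\<^bsub>Z\<^esub>)) \<in> full_group H"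
proof -
  obtain \<sigma> where s: "\<alpha> \<in> Bij (units G)" "continuous_map (unit_space G) (discrete_topology (carrier Z)) c"
    "continuous_map (unit_space G) (gtop G) \<sigma>"
    "\<And>x. x \<in> units G \<Longrightarrow> gsrc G (\<sigma> x) = lam (c x) x" "\<And>x. x \<in> units G \<Longrightarrow> grng G (\<sigma> x) = \<alpha> x"
    "\<And>x. x \<in> units G \<Longrightarrow> c x \<in> carrier Z" "\<And>x. x \<in> units G \<Longrightarrow> \<sigma> x \<in> arrows G"
    using assms by (rule labelledE) blast
  have pair: "bij_betw (\<lambda>x. (x, \<one>\<^bsub>Z\<^esub>)) (units G) (units H)" "bij_betw fst (units H) (units G)"
    by (auto simp: units_H bij_betw_def inj_on_def)
  have "bij_betw ((\<lambda>x. (x, \<one>\<^bsub>Z\<^esub>)) \<circ> (\<alpha> \<circ> fst)) (units H) (units H)"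
    by (rule bij_betw_trans[OF bij_betw_trans[OF pair(2)] pair(1)]) (use s(1) in \<open>simp add: Bij_def\<close>)
  then have bij: "(\<lambda>z\<in>units H. (\<alpha> (fst z), \<one>\<^bsub>Z\<^esub>)) \<in> Bij (units H)"
    by (simp add: Bij_def o_def)
  have "continuous_map (unit_space H) (gtop H) (\<lambda>z. (\<sigma> (fst z), c (fst z)))"
    unfolding gtop_semidirect
    using continuous_map_compose[OF continuous_unit_projection s(3)]
      continuous_map_compose[OF continuous_unit_projection s(2)]
    by (intro continuous_map_pairedI) (simp_all add: o_def)
  moreover have "gsrc H (\<sigma> x, c x) = (x, \<one>\<^bsub>Z\<^esub>)" "grng H (\<sigma> x, c x) = (\<alpha> x, \<one>\<^bsub>Z\<^esub>)" if "x \<in> units G" for x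
    using s(4-7)[OF that] unit_arrow_src_rng(1)[OF that] by (simp_all add: src_H rng_H lam_inv)
  ultimately have "source_section H (\<lambda>z\<in>units H. (\<alpha> (fst z), \<one>\<^bsub>Z\<^esub>)) (\<lambda>z. (\<sigma> (fst z), c (fst z)))"
    by (auto simp: source_section_def units_H)
  then show ?thesis unfolding full_group_H_iff using bij by blast
qed

lemma full_group_semidirect_iff: "\<alpha> \<in> full_group_semidirect G p lam \<longleftrightarrow> (\<exists>c. labelled c \<alpha>)"
proof
  assume "\<alpha> \<in> full_group_semidirect G p lam"
  then show "\<exists>c. labelled c \<alpha>"
    using full_group_H_imp_labelled by (auto simp: full_group_semidirect_def one_integer_mod_group)
next
  assume "\<exists>c. labelled c \<alpha>"
  then obtain c where c: "labelled c \<alpha>" ..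
  let ?\<theta> = "\<lambda>z\<in>units H. (\<alpha> (fst z), \<one>\<^bsub>Z\<^esub>)"
  \<comment> \<open>Outside the units both sides are \<open>undefined\<close>, because members of
    \<open>Bij\<close> are extensional.\<close>
  have "\<alpha> = (\<lambda>x\<in>units G. fst (?\<theta> (x, 0)))"
  proof
    fix x show "\<alpha> x = (\<lambda>x\<in>units G. fst (?\<theta> (x, 0))) x"
      using labelled_Bij[OF c] by (auto simp: units_H one_integer_mod_group Bij_def extensional_def)
  qed
  then show "\<alpha> \<in> full_group_semidirect G p lam"
    unfolding full_group_semidirect_def using labelled_imp_full_group_H[OF c] by (rule image_eqI)
qed

lemma subgroup_full_group_semidirect: "subgroup (full_group_semidirect G p lam) B"
proof (rule B.subgroupI)
  show "full_group_semidirect G p lam \<subseteq> carrier B"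
    by (auto simp: full_group_semidirect_iff carrier_BijGroup labelled_Bij)
  show "full_group_semidirect G p lam \<noteq> {}"
    using labelled_one full_group_semidirect_iff by blast
  show "inv\<^bsub>B\<^esub> \<alpha> \<in> full_group_semidirect G p lam" if "\<alpha> \<in> full_group_semidirect G p lam" for \<alpha>
    using that labelled_inv unfolding full_group_semidirect_iff by blast
  show "\<alpha> \<otimes>\<^bsub>B\<^esub> \<beta> \<in> full_group_semidirect G p lam"
    if "\<alpha> \<in> full_group_semidirect G p lam" "\<beta> \<in> full_group_semidirect G p lam" for \<alpha> \<beta>
    using that labelled_mult unfolding full_group_semidirect_iff by blast
qed

section \<open>Orbits of the derived full group and the inclusions between normalizers\<close>

lemma full_group_orbit: "\<alpha> \<in> full_group G \<Longrightarrow> x \<in> units G \<Longrightarrow> \<alpha> x \<in> gorbit G x"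
  unfolding full_group_iff_labelled gorbit_iff
  by (erule labelledE) (metis lam_one unit_arrow_src_rng(1))

text \<open>A finite set is closed in a Hausdorff space, so a finite dense orbit would exhaust the
  infinite unit space.\<close>

lemma infinite_orbit:
  assumes "minimal G" "x \<in> units G"
  shows "infinite (gorbit G x)"
proof
  assume "finite (gorbit G x)"
  then have "closedin (unit_space G) (gorbit G x)"
    using gorbit_subset Hausdorff_unit_space by (simp add: closedin_Hausdorff_finite topspace_unit_space)
  then have "gorbit G x = units G"
    using assms closure_of_eq unfolding minimal_def by metis
  with \<open>finite (gorbit G x)\<close> show False
    using infinite_cantor[OF cantor] by (simp add: topspace_unit_space)
qed

lemma full_group_derived_subset: "full_group_derived G \<subseteq> full_group G"
  unfolding full_group_derived_def by (rule B.derived_incl[OF order_refl subgroup_full_group])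

text \<open>Two swaps \<open>x \<leftrightarrow> y\<close> and \<open>x \<leftrightarrow> z\<close> fixing the respective third point have a commutator taking \<open>x\<close> to \<open>y\<close>.\<close>

lemma full_group_derived_transitive:
  assumes min: "minimal G" and x: "x \<in> units G" and y: "y \<in> gorbit G x"
  obtains \<delta> where "\<delta> \<in> full_group_derived G" "\<delta> x = y"
proof (cases "x = y")
  case True
  have "\<one>\<^bsub>B\<^esub> \<in> full_group_derived G"
    unfolding full_group_derived_def derived_def by (rule generate.one)
  moreover have "\<one>\<^bsub>B\<^esub> x = y" using x True by (simp add: BijGroup_def)
  ultimately show thesis by (rule that)
next
  case False
  have "infinite (gorbit G x - {x, y})"
    using infinite_orbit[OF min x] by simp
  then obtain z where z: "z \<in> gorbit G x" "z \<noteq> x" "z \<noteq> y"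
    by (metis Diff_iff ex_in_conv finite.emptyI insertCI)
  have u: "y \<in> units G" "z \<in> units G" using y z(1) gorbit_subset by blast+
  obtain g h where g: "g \<in> arrows G" "gsrc G g = x" "grng G g = y"
    and h: "h \<in> arrows G" "gsrc G h = x" "grng G h = z"
    using y z(1) unfolding gorbit_iff by blast
  obtain t where t: "t \<in> full_group G" "t x = y" "t z = z"
    using full_group_swap[of g z] g False z u by metis
  obtain t' where t': "t' \<in> full_group G" "t' x = z" "t' z = x"
    using full_group_swap[of h y] h False z u by metis
  have Bij: "t \<in> Bij (units G)" "t' \<in> Bij (units G)"
    using t t' full_group_subset by (auto simp: carrier_BijGroup)
  have inv: "(inv\<^bsub>B\<^esub> t') x = z" "(inv\<^bsub>B\<^esub> t) z = z"
    using inv_BijGroup_apply(1)[OF Bij(2) u(2)] inv_BijGroup_apply(1)[OF Bij(1) u(2)] t t' by simp_all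
  \<comment> \<open>Read from right to left: \<open>x\<close> goes to \<open>z\<close>, stays at
    \<open>z\<close>, returns to \<open>x\<close>, and then goes to \<open>y\<close>.\<close>
  let ?\<delta> = "t \<otimes>\<^bsub>B\<^esub> t' \<otimes>\<^bsub>B\<^esub> inv\<^bsub>B\<^esub> t \<otimes>\<^bsub>B\<^esub> inv\<^bsub>B\<^esub> t'"
  have "?\<delta> \<in> full_group_derived G"
    unfolding full_group_derived_def derived_def using t(1) t'(1) by (intro generate.incl) blast
  moreover have "t \<otimes>\<^bsub>B\<^esub> t' \<in> Bij (units G)" "t \<otimes>\<^bsub>B\<^esub> t' \<otimes>\<^bsub>B\<^esub> inv\<^bsub>B\<^esub> t \<in> Bij (units G)"
    using Bij B.m_closed B.inv_closed by (simp_all add: carrier_BijGroup)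
  then have "?\<delta> x = y"
    using Bij x u inv t t' inv_BijGroup_apply(4)[OF Bij(1) x] inv_BijGroup_apply(4)[OF Bij(2) x]
    by (simp add: BijGroup_mult_apply)
  ultimately show thesis by (rule that)
qed

text \<open>The cocycle rule evaluates the label of \<open>\<alpha>\<close> and that of its inverse
  at different points; since the label is constant, the two values cancel and the conjugate has
  trivial label.\<close>

lemma conj_full_group:
  assumes \<alpha>: "labelled (\<lambda>_. a) \<alpha>" and a: "a \<in> carrier Z" and \<sigma>: "\<sigma> \<in> full_group G"
  shows "\<alpha> \<otimes>\<^bsub>B\<^esub> \<sigma> \<otimes>\<^bsub>B\<^esub> inv\<^bsub>B\<^esub> \<alpha> \<in> full_group G"
  using labelled_mult[OF labelled_mult[OF \<alpha> \<sigma>[unfolded full_group_iff_labelled]] labelled_inv[OF \<alpha>]] a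
  by (simp add: full_group_iff_labelled)

text \<open>The inverse of \<open>\<alpha>\<close> again has a constant label, so
  \<open>conj_full_group\<close> covers conjugation in both directions.\<close>

lemma const_labelled_conj_stabilizer:
  assumes \<alpha>: "labelled (\<lambda>_. a) \<alpha>" and a: "a \<in> carrier Z"
  shows "\<alpha> \<in> conj_stabilizer B (full_group_semidirect G p lam) (full_group G)"
proof (rule B.mem_conj_stabilizerI)
  show "\<alpha> \<in> full_group_semidirect G p lam" using \<alpha> full_group_semidirect_iff by blast
  show \<alpha>B: "\<alpha> \<in> carrier B" using labelled_Bij[OF \<alpha>] by (simp add: carrier_BijGroup)
  show "\<alpha> \<otimes>\<^bsub>B\<^esub> \<sigma> \<otimes>\<^bsub>B\<^esub> inv\<^bsub>B\<^esub> \<alpha> \<in> full_group G" if "\<sigma> \<in> full_group G" for \<sigma>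
    using \<alpha> a that by (rule conj_full_group)
  show "inv\<^bsub>B\<^esub> \<alpha> \<otimes>\<^bsub>B\<^esub> \<sigma> \<otimes>\<^bsub>B\<^esub> \<alpha> \<in> full_group G" if "\<sigma> \<in> full_group G" for \<sigma>
    using conj_full_group[OF labelled_inv[OF \<alpha>] _ that] a \<alpha>B by simp
qed (rule full_group_subset)

text \<open>All generators have constant labels, and the normalizer is a subgroup.\<close>

lemma extension_subset_conj_stabilizer:
  "full_group_extension G p lam \<subseteq> conj_stabilizer B (full_group_semidirect G p lam) (full_group G)"
  unfolding full_group_extension_def
proof (rule B.generate_subgroup_incl)
  show "full_group G \<union> {restrict (lam a) (units G) |a. a \<in> carrier Z}
      \<subseteq> conj_stabilizer B (full_group_semidirect G p lam) (full_group G)"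
    using const_labelled_conj_stabilizer labelled_lam full_group_iff_labelled Z.one_closed by blast
  show "subgroup (conj_stabilizer B (full_group_semidirect G p lam) (full_group G)) B"
    by (rule B.conj_stabilizer_subgroup[OF subgroup_full_group_semidirect full_group_subset])
qed

lemma conj_stabilizer_derived_subset:
  "conj_stabilizer B (full_group_semidirect G p lam) (full_group G)
    \<subseteq> conj_stabilizer B (full_group_semidirect G p lam) (full_group_derived G)"
  unfolding full_group_derived_def
  by (rule B.conj_stabilizer_derived[OF subgroup.subset[OF subgroup_full_group_semidirect] full_group_subset])

lemma conj_stabilizer_subset_orbit_stabilizer:
  assumes min: "minimal G"
  shows "conj_stabilizer B (full_group_semidirect G p lam) (full_group_derived G)
    \<subseteq> orbit_partition_stabilizer G (full_group_semidirect G p lam)"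
proof
  fix \<alpha> assume "\<alpha> \<in> conj_stabilizer B (full_group_semidirect G p lam) (full_group_derived G)"
  then have F: "\<alpha> \<in> full_group_semidirect G p lam"
    and conj: "(\<lambda>\<sigma>. \<alpha> \<otimes>\<^bsub>B\<^esub> \<sigma> \<otimes>\<^bsub>B\<^esub> inv\<^bsub>B\<^esub> \<alpha>) ` full_group_derived G = full_group_derived G"
    by (auto simp: conj_stabilizer_def)
  have \<alpha>: "\<alpha> \<in> Bij (units G)" using F labelled_Bij full_group_semidirect_iff by blast
  have D: "\<delta> \<in> Bij (units G)" "\<delta> \<in> full_group G" if "\<delta> \<in> full_group_derived G" for \<delta>
    using that full_group_derived_subset full_group_subset by (auto simp: carrier_BijGroup)
  have conj_apply: "(\<alpha> \<otimes>\<^bsub>B\<^esub> \<delta> \<otimes>\<^bsub>B\<^esub> inv\<^bsub>B\<^esub> \<alpha>) (\<alpha> x) = \<alpha> (\<delta> x)"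
    if "\<delta> \<in> full_group_derived G" "x \<in> units G" for \<delta> x
  proof -
    have "\<alpha> \<otimes>\<^bsub>B\<^esub> \<delta> \<in> Bij (units G)"
      using \<alpha> D(1)[OF that(1)] B.m_closed by (simp add: carrier_BijGroup)
    then show ?thesis
      using \<alpha> D(1)[OF that(1)] that(2) inv_BijGroup_apply[OF \<alpha>] Bij_apply[OF \<alpha>]
      by (simp add: BijGroup_mult_apply)
  qed
  \<comment> \<open>By transitivity of D(G) on G-orbits, it suffices to move elements of D(G) across
    \<open>\<alpha>\<close>. The first inclusion uses that conjugates of D(G) stay in D(G), the
    second that every element of D(G) is such a conjugate.\<close>
  have "\<alpha> ` gorbit G x = gorbit G (\<alpha> x)" if x: "x \<in> units G" for x
  proof (intro equalityI subsetI)
    fix w assume "w \<in> \<alpha> ` gorbit G x"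
    then obtain y where y: "y \<in> gorbit G x" "w = \<alpha> y" by blast
    obtain \<delta> where \<delta>: "\<delta> \<in> full_group_derived G" "\<delta> x = y"
      using full_group_derived_transitive[OF min x y(1)] .
    have "\<alpha> \<otimes>\<^bsub>B\<^esub> \<delta> \<otimes>\<^bsub>B\<^esub> inv\<^bsub>B\<^esub> \<alpha> \<in> full_group_derived G"
      using conj \<delta>(1) by blast
    then show "w \<in> gorbit G (\<alpha> x)"
      using full_group_orbit[OF D(2) Bij_apply[OF \<alpha> x]] conj_apply[OF \<delta>(1) x] \<delta>(2) y(2) by metis
  next
    fix w assume "w \<in> gorbit G (\<alpha> x)"
    then obtain \<epsilon> where \<epsilon>: "\<epsilon> \<in> full_group_derived G" "\<epsilon> (\<alpha> x) = w"
      using full_group_derived_transitive[OF min Bij_apply[OF \<alpha> x]] by blast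
    then obtain \<delta> where \<delta>: "\<delta> \<in> full_group_derived G" "\<epsilon> = \<alpha> \<otimes>\<^bsub>B\<^esub> \<delta> \<otimes>\<^bsub>B\<^esub> inv\<^bsub>B\<^esub> \<alpha>"
      using conj by blast
    then have "w = \<alpha> (\<delta> x)" using conj_apply[OF \<delta>(1) x] \<epsilon>(2) by simp
    then show "w \<in> \<alpha> ` gorbit G x"
      using full_group_orbit[OF D(2)[OF \<delta>(1)] x] by blast
  qed
  then show "\<alpha> \<in> orbit_partition_stabilizer G (full_group_semidirect G p lam)"
    using F Bij_apply[OF \<alpha>] by (auto simp: orbit_partition_stabilizer_def)
qed

section \<open>Effectiveness, Baire category and constancy of the label\<close>

text \<open>For \<open>g\<close> in \<open>V\<close> the arrow \<open>(g, c)\<close> has equal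
  source and range, the twist by \<open>c\<close> being undone by the source formula. So
  \<open>V \<times> {c}\<close> is an open set of isotropy; effectiveness makes its members units,
  whose second coordinate is neutral, against the choice of \<open>c\<close>.\<close>

lemma twisted_isotropy_interior:
  assumes eff: "effective H" and V: "openin (gtop G) V" and c: "c \<in> carrier Z" "c \<noteq> \<one>\<^bsub>Z\<^esub>"
    and iso: "\<And>g. g \<in> V \<Longrightarrow> gsrc G g = lam c (grng G g)"
  shows "V = {}"
proof -
  have VG: "V \<subseteq> arrows G" using openin_subset[OF V] by (simp add: arrows_def)
  have "openin (gtop H) (V \<times> {c})"
    unfolding gtop_semidirect openin_prod_Times_iff using V c(1) by simp
  moreover have "V \<times> {c} \<subseteq> isotropy H"
    using VG c(1) iso rng_in_units unit_arrow_src_rng(1)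
    by (auto simp: isotropy_def arrows_semidirect src_H rng_H lam_inv subset_iff)
  ultimately have "V \<times> {c} \<subseteq> units H"
    using eff unfolding effective_def by (metis interior_of_maximal)
  then show ?thesis using c(2) by (auto simp: units_H)
qed

text \<open>The arrows excluded here are those from \<open>lam c x\<close> to \<open>x\<close> with \<open>c\<close> nontrivial. By the previous lemma the
  units \<open>x\<close> they hit form a countable union of closed sets without interior.\<close>

lemma exists_untwisted_unit:
  assumes eff: "effective H"
  obtains x where "x \<in> units G"
    "\<And>g c. g \<in> arrows G \<Longrightarrow> c \<in> carrier Z \<Longrightarrow> grng G g = x \<Longrightarrow> gsrc G g = lam c x \<Longrightarrow> c = \<one>\<^bsub>Z\<^esub>"
proof -
  define A where "A c = {g \<in> topspace (gtop G). gsrc G g = lam c (grng G g)}" for c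
  have closedA: "closedin (gtop G) (A c)" if "c \<in> carrier Z" for c
    unfolding A_def
  proof (rule closedin_continuous_maps_eq[OF Hausdorff])
    show "continuous_map (gtop G) (gtop G) (gsrc G)"
      using continuous_src unfolding unit_space_def by (rule continuous_map_into_fulltopology)
    have "continuous_map (gtop G) (gtop G) (lam c \<circ> grng G)"
      using continuous_map_into_fulltopology[OF continuous_rng[unfolded unit_space_def]] continuous_lam[OF that]
      by (rule continuous_map_compose)
    then show "continuous_map (gtop G) (gtop G) (\<lambda>g. lam c (grng G g))" by (simp add: o_def)
  qed
  let ?\<V> = "{V. compact_open_bisection G V}"
  have "\<Union>?\<V> = topspace (gtop G)"
  proof
    show "\<Union>?\<V> \<subseteq> topspace (gtop G)"
      by (auto simp: compact_open_bisection_def dest: openin_subset)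
    show "topspace (gtop G) \<subseteq> \<Union>?\<V>"
      using compact_open_bisection_base[OF openin_topspace] by blast
  qed
  then obtain \<C> where \<C>: "countable \<C>" "\<C> \<subseteq> ?\<V>" "\<Union>\<C> = topspace (gtop G)"
    using Lindelof_spaceD[OF second_countable_imp_Lindelof_space[OF second_countable], of ?\<V>]
    by (auto simp: compact_open_bisection_def)
  \<comment> \<open>Cutting along compact open bisections serves twice: the range of each compact
    piece is closed, and injectivity of the range on \<open>V\<close> lets an open set of bad units
    be lifted to an open set of bad arrows.\<close>
  let ?\<G> = "(\<lambda>(c, V). grng G ` (V \<inter> A c)) ` ((carrier Z - {\<one>\<^bsub>Z\<^esub>}) \<times> \<C>)"
  have "unit_space G interior_of \<Union>?\<G> = {}"
  proof (rule Baire_category_alt)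
    show "completely_metrizable_space (unit_space G) \<or>
        locally_compact_space (unit_space G) \<and> regular_space (unit_space G)"
      using compact_unit_space Hausdorff_unit_space
      by (simp add: compact_imp_locally_compact_space compact_Hausdorff_imp_regular_space)
    show "countable ?\<G>" using \<C>(1) by (intro countable_image countable_SIGMA) auto
    fix T assume "T \<in> ?\<G>"
    then obtain c V where c: "c \<in> carrier Z" "c \<noteq> \<one>\<^bsub>Z\<^esub>" and V: "V \<in> \<C>" and T: "T = grng G ` (V \<inter> A c)"
      by auto
    have V': "compactin (gtop G) V" "openin (gtop G) V" "inj_on (grng G) V"
      using V \<C>(2) by (auto simp: compact_open_bisection_def bisection_def)
    have "closedin (unit_space G) T"
      unfolding T using V'(1) closedA[OF c(1)]
      by (intro compactin_imp_closedin[OF Hausdorff_unit_space] image_compactin[OF _ continuous_rng]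
          compact_Int_closedin)
    moreover have "unit_space G interior_of T = {}"
    proof -
      define W where "W = unit_space G interior_of T"
      have WT: "W \<subseteq> T" unfolding W_def by (rule interior_of_subset)
      let ?V = "{g \<in> V. grng G g \<in> W}"
      have "openin (gtop G) ?V"
        unfolding W_def by (intro openin_continuous_map_preimage_gen[OF continuous_rng V'(2)]) simp
      moreover have "gsrc G g = lam c (grng G g)" if "g \<in> ?V" for g
      proof -
        have "grng G g \<in> grng G ` (V \<inter> A c)" using that WT T by blast
        then have "g \<in> A c" using V'(3) that by (auto simp: inj_on_def)
        then show ?thesis by (simp add: A_def)
      qed
      ultimately have "?V = {}" by (rule twisted_isotropy_interior[OF eff _ c])
      then show ?thesis using WT T by (auto simp: W_def)
    qed
    ultimately show "closedin (unit_space G) T \<and> unit_space G interior_of T = {}" ..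
  qed
  moreover have "units G \<noteq> {}" using infinite_cantor[OF cantor] by (auto simp: topspace_unit_space)
  moreover have "unit_space G interior_of units G = units G"
    by (metis interior_of_topspace topspace_unit_space)
  \<comment> \<open>The whole unit space is open and nonempty, so it cannot lie in a set with empty
    interior.\<close>
  ultimately have "\<not> units G \<subseteq> \<Union>?\<G>"
    by (metis interior_of_mono subset_empty)
  then obtain x where x: "x \<in> units G" "x \<notin> \<Union>?\<G>" by blast
  show thesis
  proof (rule that[OF x(1)], rule ccontr)
    fix g c assume g: "g \<in> arrows G" "grng G g = x" "gsrc G g = lam c x" and c: "c \<in> carrier Z" "c \<noteq> \<one>\<^bsub>Z\<^esub>"
    then obtain V where "V \<in> \<C>" "g \<in> V" using \<C>(3) by (auto simp: arrows_def)
    moreover have "g \<in> A c" using g by (simp add: A_def arrows_def)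
    ultimately have "x \<in> \<Union>?\<G>" using c g(2) by force
    with x(2) show False ..
  qed
qed

lemma gorbit_lam:
  assumes "a \<in> carrier Z" "y \<in> gorbit G x"
  shows "lam a y \<in> gorbit G (lam a x)"
  using assms unfolding gorbit_iff by (metis lam_arrow lam_rng lam_src)

lemma orbit_stabilizer_label_constant:
  assumes eff: "effective H" and min: "minimal G" and c: "labelled c \<alpha>"
    and stab: "\<And>x. x \<in> units G \<Longrightarrow> \<exists>y\<in>units G. \<alpha> ` gorbit G x = gorbit G y"
  obtains a where "a \<in> carrier Z" "\<And>x. x \<in> units G \<Longrightarrow> c x = a"
proof -
  obtain \<sigma> where s: "\<alpha> \<in> Bij (units G)" "continuous_map (unit_space G) (discrete_topology (carrier Z)) c"
    "continuous_map (unit_space G) (gtop G) \<sigma>"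
    "\<And>x. x \<in> units G \<Longrightarrow> gsrc G (\<sigma> x) = lam (c x) x" "\<And>x. x \<in> units G \<Longrightarrow> grng G (\<sigma> x) = \<alpha> x"
    "\<And>x. x \<in> units G \<Longrightarrow> c x \<in> carrier Z" "\<And>x. x \<in> units G \<Longrightarrow> \<sigma> x \<in> arrows G"
    using c by (rule labelledE) blast
  obtain x where x: "x \<in> units G"
    and untwisted: "\<And>g d. g \<in> arrows G \<Longrightarrow> d \<in> carrier Z \<Longrightarrow> grng G g = x \<Longrightarrow> gsrc G g = lam d x \<Longrightarrow> d = \<one>\<^bsub>Z\<^esub>"
    using exists_untwisted_unit[OF eff] by blast
  have \<alpha>_orbit: "\<alpha> w \<in> gorbit G (lam (c w) w)" if "w \<in> units G" for w
    unfolding gorbit_iff using s(4,5,7)[OF that] by blast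
  \<comment> \<open>Since \<open>lam\<close> maps G-orbits to G-orbits, \<open>\<alpha> w\<close>
    lies in the orbit of \<open>lam (c w) x\<close>, while \<open>\<alpha> x\<close> lies in that of
    \<open>lam (c x) x\<close>. As \<open>\<alpha> w\<close> and \<open>\<alpha> x\<close> share an
    orbit, undoing \<open>c w\<close> puts \<open>x\<close> in the orbit of its translate by the
    quotient of the two labels, which the choice of \<open>x\<close> forces to be trivial.\<close>
  have const: "c w = c x" if w: "w \<in> gorbit G x" for w
  proof -
    have wu: "w \<in> units G" using w gorbit_subset by blast
    obtain y where y: "\<alpha> ` gorbit G x = gorbit G y" using stab[OF x] by blast
    have "\<alpha> w \<in> gorbit G y" "\<alpha> x \<in> gorbit G y" using y w gorbit_refl[OF x] by blast+
    then have "\<alpha> x \<in> gorbit G (\<alpha> w)" using gorbit_eq by blast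
    moreover have "\<alpha> w \<in> gorbit G (lam (c w) x)"
      using \<alpha>_orbit[OF wu] gorbit_lam[OF s(6)[OF wu] w] gorbit_trans by blast
    ultimately have "\<alpha> x \<in> gorbit G (lam (c w) x)" using gorbit_trans by blast
    then have "lam (c w) x \<in> gorbit G (lam (c x) x)"
      using \<alpha>_orbit[OF x] gorbit_sym gorbit_trans by blast
    then have "lam (inv\<^bsub>Z\<^esub> c w) (lam (c w) x) \<in> gorbit G (lam (inv\<^bsub>Z\<^esub> c w) (lam (c x) x))"
      using s(6)[OF wu] by (intro gorbit_lam) auto
    then have "x \<in> gorbit G (lam (inv\<^bsub>Z\<^esub> c w \<otimes>\<^bsub>Z\<^esub> c x) x)"
      using s(6)[OF wu] s(6)[OF x] unit_arrow_src_rng(1)[OF x] by (simp add: lam_inv lam_mult)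
    then have "inv\<^bsub>Z\<^esub> c w \<otimes>\<^bsub>Z\<^esub> c x = \<one>\<^bsub>Z\<^esub>"
      unfolding gorbit_iff using untwisted s(6)[OF wu] s(6)[OF x] Z.m_closed Z.inv_closed by blast
    then show ?thesis using s(6)[OF wu] s(6)[OF x] by (metis Z.inv_equality Z.inv_inv Z.inv_closed)
  qed
  \<comment> \<open>A level set of a continuous map to a discrete space is closed; this one contains
    a dense orbit.\<close>
  have "closedin (unit_space G) {w \<in> topspace (unit_space G). c w \<in> {c x}}"
    using s(6)[OF x] by (intro closedin_continuous_map_preimage[OF s(2)]) simp
  then have "unit_space G closure_of gorbit G x \<subseteq> {w \<in> topspace (unit_space G). c w \<in> {c x}}"
    using const gorbit_subset by (intro closure_of_minimal) (auto simp: topspace_unit_space)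
  then have "c w = c x" if "w \<in> units G" for w
    using min x that by (auto simp: minimal_def)
  then show thesis using that s(6)[OF x] by blast
qed

lemma orbit_stabilizer_subset_extension:
  assumes eff: "effective H" and min: "minimal G"
  shows "orbit_partition_stabilizer G (full_group_semidirect G p lam) \<subseteq> full_group_extension G p lam"
proof
  fix \<alpha> assume "\<alpha> \<in> orbit_partition_stabilizer G (full_group_semidirect G p lam)"
  then obtain c where c: "labelled c \<alpha>" and stab: "\<And>x. x \<in> units G \<Longrightarrow> \<exists>y\<in>units G. \<alpha> ` gorbit G x = gorbit G y"
    by (auto simp: orbit_partition_stabilizer_def full_group_semidirect_iff)
  obtain a where a: "a \<in> carrier Z" "\<And>x. x \<in> units G \<Longrightarrow> c x = a"
    using orbit_stabilizer_label_constant[OF eff min c stab] by blast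
  let ?l = "restrict (lam a) (units G)"
  have \<alpha>: "labelled (\<lambda>_. a) \<alpha>" using c a(2) by (rule labelled_cong)
  have l: "labelled (\<lambda>_. a) ?l" using a(1) by (rule labelled_lam)
  have carr: "\<alpha> \<in> carrier B" "?l \<in> carrier B"
    using labelled_Bij[OF \<alpha>] labelled_Bij[OF l] by (simp_all add: carrier_BijGroup)
  \<comment> \<open>Dividing by the action of \<open>a\<close> leaves a trivial label, so
    \<open>\<alpha>\<close> is an element of F(G) times a generator of the extension.\<close>
  have "\<alpha> \<otimes>\<^bsub>B\<^esub> inv\<^bsub>B\<^esub> ?l \<in> full_group G"
    using labelled_mult[OF \<alpha> labelled_inv[OF l]] a(1) by (simp add: full_group_iff_labelled)
  then have "(\<alpha> \<otimes>\<^bsub>B\<^esub> inv\<^bsub>B\<^esub> ?l) \<otimes>\<^bsub>B\<^esub> ?l \<in> full_group_extension G p lam"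
    unfolding full_group_extension_def using a(1) by (intro generate.eng generate.incl) blast+
  then show "\<alpha> \<in> full_group_extension G p lam"
    using carr by (simp add: B.m_assoc)
qed

end

theorem lemma5p4:
  fixes G :: "'a groupoid" and p :: nat and lam :: "int \<Rightarrow> 'a \<Rightarrow> 'a"
  assumes "prime p"
    and "ample_groupoid G"
    and "cantor_set_space (unit_space G)"
    and "cyclic_action p G lam"
    and "free_on_units p G lam"
    and "effective G" and "minimal G"
    and "almost_finite G \<or> purely_infinite G"
    and "effective (semidirect G p lam)" and "minimal (semidirect G p lam)"
    and "almost_finite (semidirect G p lam) \<or> purely_infinite (semidirect G p lam)"
  shows "full_group_extension G p lam =
           conj_stabilizer (BijGroup (units G)) (full_group_semidirect G p lam) (full_group G)
       \<and> full_group_extension G p lam =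
           conj_stabilizer (BijGroup (units G)) (full_group_semidirect G p lam) (full_group_derived G)
       \<and> full_group_extension G p lam =
           orbit_partition_stabilizer G (full_group_semidirect G p lam)"
proof -
  interpret cantor_action G p lam
    using assms(2-4) by (simp add: cantor_action_def cantor_groupoid_def
        cantor_groupoid_axioms_def cantor_action_axioms_def)
  \<comment> \<open>The four inclusions close up into a cycle: extension, normalizer of F(G),
    normalizer of D(G), orbit stabilizer, extension.\<close>
  show ?thesis
    using extension_subset_conj_stabilizer conj_stabilizer_derived_subset
      conj_stabilizer_subset_orbit_stabilizer[OF assms(7)]
      orbit_stabilizer_subset_extension[OF assms(9,7)]
    by blast
qed

end
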